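(* Let $n\in\mathbb{N}$, $n\geq2$. Let $X(\mathbb{R}^n)$ and $Y(\mathbb{R}^n)$ be rearrangement-invariant function spaces. There is a constant $C>0$, depending only on the dimension $n$, such that $$\|u\chi_{\mathbb{R}^n\setminus B_R}\|_{Y(\mathbb{R}^n)}\leq C\Big(\sup_{\|f\|_{\overline{X}(0,\infty)}\leq1}\|f^*\chi_{(R^{n-1},\infty)}\|_{\overline{Y}(0,\infty)}\Big)\|u\|_{W^1X(\mathbb{R}^n)}$$ for every $u\in W^1_RX(\mathbb{R}^n)$ and every $R>0$. In particular, if $$\lim_{a\to\infty}\ \sup_{\|f\|_{\overline{X}(0,\infty)}\leq1}\|f^*\chi_{(a,\infty)}\|_{\overline{Y}(0,\infty)}=0,$$ then $$\lim_{R\to\infty}\ \sup_{u\in M}\|u\chi_{\mathbb{R}^n\setminus B_R}\|_{Y(\mathbb{R}^n)}=0$$ for every bounded set $M$ in $W^1_RX(\mathbb{R}^n)$.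
   Context: $B_R$ is the open ball in $\mathbb{R}^n$ centered at the origin with radius $R$. Convention: $0\cdot\infty=0$. For a $\sigma$-finite nonatomic nontrivial measure space $(S,\mu)$, let $\mathcal{M}(S,\mu)$ be the set of $\mu$-measurable functions and $\mathcal{M}^+(S,\mu)$ the set of those that are nonnegative $\mu$-a.e. Subsets of $\mathbb{R}^n$ and intervals carry the Lebesgue measure. The nonincreasing rearrangement of $f$ is $f^*(t)=\inf\{\lambda>0:\mu(\{|f|>\lambda\})\leq t\}$, $t\in(0,\infty)$. Two functions are equimeasurable if their distribution functions $\lambda\mapsto\mu(\{|f|>\lambda\})$ coincide. A functional $\|\cdot\|_{X(S,\mu)}:\mathcal{M}^+(S,\mu)\to[0,\infty]$ is a rearrangement-invariant (r.i.) function norm if for all $f,g,f_k\in\mathcal{M}^+(S,\mu)$, $\lambda\ge0$: (P1) $\|f+g\|\le\|f\|+\|g\|$, $\|f\|=0$ iff $f=0$ a.e., $\|\lambda f\|=\lambda\|f\|$; (P2) $f\le g$ a.e. implies $\|f\|\le\|g\|$; (P3) $f_k\nearrow f$ a.e. implies $\|f_k\|\nearrow\|f\|$; (P4) $\|\chi_E\|<\infty$ whenever $\mu(E)<\infty$; (P5) if $\mu(E)<\infty$ there is $C_E\in(0,\infty)$ independent of $f$ with $\int_E f\,d\mu\le C_E\|f\|$; (P6) $\|f\|=\|g\|$ whenever $f,g$ are equimeasurable. It is extended to $\mathcal{M}(S,\mu)$ by $\|f\|=\|\,|f|\,\|$, and $X(S,\mu)=\{f\in\mathcal{M}(S,\mu):\|f\|_{X(S,\mu)}<\infty\}$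 is the corresponding rearrangement-invariant function space. For $X(\mathbb{R}^n)$, $\overline{X}(0,\infty)$ denotes the unique r.i. space over $(0,\infty)$ with $\|f\|_{X(\mathbb{R}^n)}=\|f^*\|_{\overline{X}(0,\infty)}$ for every $f\in\mathcal{M}(\mathbb{R}^n)$. $W^1X(\mathbb{R}^n)$ is the set of weakly differentiable $u\in X(\mathbb{R}^n)$ with $|\nabla u|\in X(\mathbb{R}^n)$, with norm $\|u\|_{W^1X(\mathbb{R}^n)}=\|u\|_{X(\mathbb{R}^n)}+\|\,|\nabla u|\,\|_{X(\mathbb{R}^n)}$. $W^1_RX(\mathbb{R}^n)$ is its subspace of radially symmetric functions (functions equal a.e. to a function of $|x|$). *)

theory Defs
  imports "HOL-Analysis.Analysis"
begin

text \<open>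
  Elements of \<open>\<M>\<^sup>+(S,\<mu>)\<close> are represented by \<open>ennreal\<close>-valued measurable functions; the value
  \<open>\<infinity>\<close> has to be admitted because a nonincreasing rearrangement may take it. A functional is only
  constrained on measurable functions, and by monotonicity it depends only on the
  equivalence class modulo a.e. equality.
\<close>

definition equimeasurable :: "'a measure \<Rightarrow> ('a \<Rightarrow> ennreal) \<Rightarrow> ('a \<Rightarrow> ennreal) \<Rightarrow> bool" where
  "equimeasurable M f g \<longleftrightarrow>
     (\<forall>l::real. l \<ge> 0 \<longrightarrow>
        emeasure M {x \<in> space M. f x > ennreal l} = emeasure M {x \<in> space M. g x > ennreal l})"

text \<open>The infimum of the empty set is \<open>\<infinity>\<close>; only the values at \<open>t > 0\<close> are meaningful.\<close>

definition rearrangement :: "'a measure \<Rightarrow> ('a \<Rightarrow> ennreal) \<Rightarrow> real \<Rightarrow> ennreal" where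
  "rearrangement M f t =
     (INF l \<in> {l::real. l > 0 \<and> emeasure M {x \<in> space M. f x > ennreal l} \<le> ennreal t}. ennreal l)"

locale ri_function_norm =
  fixes M :: "'a measure" and N :: "('a \<Rightarrow> ennreal) \<Rightarrow> ennreal"
  assumes triangle: "\<And>f g. f \<in> borel_measurable M \<Longrightarrow> g \<in> borel_measurable M \<Longrightarrow>
      N (\<lambda>x. f x + g x) \<le> N f + N g"
    and zero_iff: "\<And>f. f \<in> borel_measurable M \<Longrightarrow> N f = 0 \<longleftrightarrow> (AE x in M. f x = 0)"
    and scale: "\<And>f l. f \<in> borel_measurable M \<Longrightarrow> l \<ge> 0 \<Longrightarrow>
      N (\<lambda>x. ennreal l * f x) = ennreal l * N f"
    and mono: "\<And>f g. f \<in> borel_measurable M \<Longrightarrow> g \<in> borel_measurable M \<Longrightarrow>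
      AE x in M. f x \<le> g x \<Longrightarrow> N f \<le> N g"
    and fatou: "\<And>F f. (\<And>k::nat. F k \<in> borel_measurable M) \<Longrightarrow> f \<in> borel_measurable M \<Longrightarrow>
      AE x in M. incseq (\<lambda>k. F k x) \<and> (\<lambda>k. F k x) \<longlonglongrightarrow> f x \<Longrightarrow>
      incseq (\<lambda>k. N (F k)) \<and> (\<lambda>k. N (F k)) \<longlonglongrightarrow> N f"
    and finite_indicator: "\<And>E. E \<in> sets M \<Longrightarrow> emeasure M E < \<infinity> \<Longrightarrow> N (indicator E) < \<infinity>"
    and local_embedding: "\<And>E. E \<in> sets M \<Longrightarrow> emeasure M E < \<infinity> \<Longrightarrow>
      \<exists>C::real. C > 0 \<and>
        (\<forall>f \<in> borel_measurable M. (\<integral>\<^sup>+x\<in>E. f x \<partial>M) \<le> ennreal C * N f)"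
    and rearrangement_invariant: "\<And>f g. f \<in> borel_measurable M \<Longrightarrow> g \<in> borel_measurable M \<Longrightarrow>
      equimeasurable M f g \<Longrightarrow> N f = N g"

abbreviation half_line :: "real measure" where
  "half_line \<equiv> lebesgue_on {0<..}"

text \<open>
  \<open>represents Xb X\<close>: \<open>Xb\<close> is the representation norm over \<open>(0,\<infinity>)\<close> of the norm \<open>X\<close> over
  \<open>\<real>\<^sup>n\<close>. It exists and is unique on measurable functions by Luxemburg's
  representation theorem.
\<close>

definition represents ::
  "((real \<Rightarrow> ennreal) \<Rightarrow> ennreal) \<Rightarrow> ((real^'n::finite \<Rightarrow> ennreal) \<Rightarrow> ennreal) \<Rightarrow> bool" where
  "represents Xb X \<longleftrightarrow>
     ri_function_norm half_line Xb \<and>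
     (\<forall>f \<in> borel_measurable lebesgue. X f = Xb (rearrangement lebesgue f))"

definition fnorm :: "(('a \<Rightarrow> ennreal) \<Rightarrow> ennreal) \<Rightarrow> ('a \<Rightarrow> real) \<Rightarrow> ennreal" where
  "fnorm N u = N (\<lambda>x. ennreal \<bar>u x\<bar>)"

definition ri_space :: "'a measure \<Rightarrow> (('a \<Rightarrow> ennreal) \<Rightarrow> ennreal) \<Rightarrow> ('a \<Rightarrow> real) set" where
  "ri_space M N = {u \<in> borel_measurable M. fnorm N u < \<infinity>}"

text \<open>
  \<open>f\<^sup>*\<close> and the norm of \<open>f\<close> depend only on \<open>\<bar>f\<bar>\<close>, so the supremum over the unit ball may
  be taken over nonnegative functions.
\<close>

definition tail_sup ::
  "((real \<Rightarrow> ennreal) \<Rightarrow> ennreal) \<Rightarrow> ((real \<Rightarrow> ennreal) \<Rightarrow> ennreal) \<Rightarrow> real \<Rightarrow> ennreal" where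
  "tail_sup Xb Yb a =
     (SUP f \<in> {f \<in> borel_measurable half_line. Xb f \<le> 1}.
        Yb (\<lambda>t. rearrangement half_line f t * indicator {a<..} t))"


definition partial_deriv :: "'n::finite \<Rightarrow> (real^'n \<Rightarrow> real) \<Rightarrow> real^'n \<Rightarrow> real" where
  "partial_deriv i f x = frechet_derivative f (at x) (axis i 1)"

primrec Ck :: "nat \<Rightarrow> (real^'n::finite \<Rightarrow> real) \<Rightarrow> bool" where
  "Ck 0 f \<longleftrightarrow> continuous_on UNIV f"
| "Ck (Suc k) f \<longleftrightarrow> (\<forall>x. f differentiable (at x)) \<and> (\<forall>i. Ck k (partial_deriv i f))"

definition test_function :: "(real^'n::finite \<Rightarrow> real) \<Rightarrow> bool" where
  "test_function \<phi> \<longleftrightarrow> (\<forall>k. Ck k \<phi>) \<and> compact (closure {x. \<phi> x \<noteq> 0})"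

definition locally_integrable :: "(real^'n::finite \<Rightarrow> 'b::euclidean_space) \<Rightarrow> bool" where
  "locally_integrable f \<longleftrightarrow>
     f \<in> borel_measurable lebesgue \<and> (\<forall>K. compact K \<longrightarrow> set_integrable lebesgue K f)"

definition has_weak_gradient ::
  "(real^'n::finite \<Rightarrow> real) \<Rightarrow> (real^'n \<Rightarrow> real^'n) \<Rightarrow> bool" where
  "has_weak_gradient u v \<longleftrightarrow>
     locally_integrable u \<and> locally_integrable v \<and>
     (\<forall>\<phi> i. test_function \<phi> \<longrightarrow>
        (LINT x|lebesgue. u x * partial_deriv i \<phi> x) = - (LINT x|lebesgue. v x $ i * \<phi> x))"

definition weakly_differentiable :: "(real^'n::finite \<Rightarrow> real) \<Rightarrow> bool" where
  "weakly_differentiable u \<longleftrightarrow> (\<exists>v. has_weak_gradient u v)"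

text \<open>A weak gradient is unique up to a.e. equality, so the choice does not affect any norm of it.\<close>

definition weak_gradient :: "(real^'n::finite \<Rightarrow> real) \<Rightarrow> real^'n \<Rightarrow> real^'n" where
  "weak_gradient u = (SOME v. has_weak_gradient u v)"

definition W1 :: "((real^'n::finite \<Rightarrow> ennreal) \<Rightarrow> ennreal) \<Rightarrow> (real^'n \<Rightarrow> real) set" where
  "W1 X = {u \<in> ri_space lebesgue X.
     weakly_differentiable u \<and> (\<lambda>x. norm (weak_gradient u x)) \<in> ri_space lebesgue X}"

definition W1_norm ::
  "((real^'n::finite \<Rightarrow> ennreal) \<Rightarrow> ennreal) \<Rightarrow> (real^'n \<Rightarrow> real) \<Rightarrow> ennreal" where
  "W1_norm X u = fnorm X u + fnorm X (\<lambda>x. norm (weak_gradient u x))"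

definition radially_symmetric :: "(real^'n::finite \<Rightarrow> real) \<Rightarrow> bool" where
  "radially_symmetric u \<longleftrightarrow> (\<exists>g::real \<Rightarrow> real. AE x in lebesgue. u x = g (norm x))"

definition W1_rad :: "((real^'n::finite \<Rightarrow> ennreal) \<Rightarrow> ennreal) \<Rightarrow> (real^'n \<Rightarrow> real) set" where
  "W1_rad X = {u \<in> W1 X. radially_symmetric u}"

definition W1_bounded ::
  "((real^'n::finite \<Rightarrow> ennreal) \<Rightarrow> ennreal) \<Rightarrow> (real^'n \<Rightarrow> real) set \<Rightarrow> bool" where
  "W1_bounded X A \<longleftrightarrow> (\<exists>K::real. \<forall>u\<in>A. W1_norm X u \<le> ennreal K)"

definition exterior_norm ::
  "((real^'n::finite \<Rightarrow> ennreal) \<Rightarrow> ennreal) \<Rightarrow> real \<Rightarrow> (real^'n \<Rightarrow> real) \<Rightarrow> ennreal" where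
  "exterior_norm Y R u = fnorm Y (\<lambda>x. u x * indicator (UNIV - ball 0 R) x)"

end

theory Submission
  imports Defs
begin

text \<open>
  Write \<open>a = R\<^bsup>n-1\<^esup>\<close>, \<open>v = \<nabla>u\<close>, \<open>F = |u| + |v|\<close>, and let \<open>w\<close> be \<open>|u|\<close> cut off to the complement of
  the ball of radius \<open>R\<close>. Everything rests on a pointwise decay estimate of Strauss type:
  \<open>w \<le> b\<close> almost everywhere for a number \<open>b\<close> with
  \<open>b \<parallel>\<chi>\<^bsub>(0,a)\<^esub>\<parallel> \<le> C \<parallel>F\<parallel>\<close>, the first norm being the representation norm and the second that of \<open>X\<close>.

  Given this, consider on the half-line the function \<open>h\<close> that equals \<open>b\<close> on \<open>(0,a]\<close> and
  \<open>w\<^sup>*(t - a)\<close> for \<open>t > a\<close>. The triangle inequality bounds its norm by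
  \<open>b \<parallel>\<chi>\<^bsub>(0,a)\<^esub>\<parallel> + \<parallel>w\<parallel> \<le> (C + 1) \<parallel>u\<parallel>\<^bsub>W\<^esub>\<close>, the last norm being that of \<open>W\<^sup>1X\<close>. Since \<open>b\<close> dominates
  \<open>w\<close>, the plateau pushes the values of \<open>w\<^sup>*\<close> to the right by exactly \<open>a\<close>, so \<open>h\<^sup>*(t) \<ge> w\<^sup>*(t - a)\<close>
  for \<open>t > a\<close>; hence the norm of \<open>w\<close> in \<open>Y\<close> is at most the norm of \<open>h\<^sup>*\<close> restricted to \<open>(a,\<infinity>)\<close>, which
  the supremum in the statement controls (\<open>norm_le_tail_sup\<close>).

  For the decay estimate write \<open>u(x) = g(|x|)\<close>. Comparing \<open>g(r)\<close> with an average of \<open>g\<close> over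
  \<open>(r, r + 1)\<close> gives \<open>|g(r)| \<le> K \<integral> (|g| + |g'|)\<close> over that interval, which is a multiple of the integral
  of \<open>F\<close> over the shell \<open>r < |x| < r + 1\<close> with weight \<open>|x|\<^bsup>1-n\<^esup>\<close>. In the weak
  formulation this comes from testing with the vector field \<open>x \<eta>(|x|) / |x|\<^sup>n\<close>, whose divergence is
  \<open>\<eta>'(|x|) |x|\<^bsup>1-n\<^esup>\<close> (\<open>weak_gradient_radial_test\<close>, \<open>radial_mean_bound\<close>, \<open>radial_sup_bound\<close>). For
  \<open>r \<ge> R\<close> the weight is at most \<open>1/a\<close>, and its total mass is the area of the unit sphere, whatever
  \<open>r\<close> is. By the bathtub principle (\<open>weighted_integral_le_rearrangement\<close>) the weighted integral is at
  most \<open>1/a\<close> times the integral of \<open>F\<^sup>*\<close> over \<open>(0, m a)\<close>, with \<open>m\<close> depending only on \<open>n\<close>. Finally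
  averaging a nonincreasing function over an initial interval does not increase a rearrangement-invariant
  norm (\<open>norm_indicator_times_integral_le\<close>), which turns this integral into \<open>\<parallel>F\<parallel>\<close>. All constants are
  the same for small and for large \<open>R\<close>.
\<close>

section \<open>Rearrangements\<close>

text \<open>
  Distribution functions are right-continuous, so a bound on the rearrangement passes from all levels
  above \<open>l\<close> to \<open>l\<close> itself; the rearrangement and the distribution function form a Galois connection.
\<close>

lemma rearrangement_le_iff:
  assumes [measurable]: "f \<in> borel_measurable M" and l: "l \<ge> 0"
  shows "rearrangement M f t \<le> ennreal l
    \<longleftrightarrow> emeasure M {x \<in> space M. f x > ennreal l} \<le> ennreal t"
proof
  assume le: "rearrangement M f t \<le> ennreal l"
  have small: "emeasure M {x \<in> space M. f x > ennreal k} \<le> ennreal t" if "l < k" for k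
  proof -
    have "rearrangement M f t < ennreal k"
      using le that l by (meson ennreal_lessI le_less_trans less_le_trans)
    then obtain m where m: "m > 0" "emeasure M {x \<in> space M. f x > ennreal m} \<le> ennreal t"
      "ennreal m < ennreal k"
      unfolding rearrangement_def INF_less_iff by auto
    have "emeasure M {x \<in> space M. f x > ennreal k} \<le> emeasure M {x \<in> space M. f x > ennreal m}"
      using m by (intro emeasure_mono) auto
    then show ?thesis using m by auto
  qed
  have eq: "{x \<in> space M. f x > ennreal l}
      = (\<Union>k::nat. {x \<in> space M. f x > ennreal (l + 1 / Suc k)})" (is "_ = (\<Union>k. ?A k)")
  proof (intro equalityI subsetI)
    fix x assume x: "x \<in> {x \<in> space M. f x > ennreal l}"
    have "(\<lambda>k. ennreal (l + 1 / Suc k)) \<longlonglongrightarrow> ennreal (l + 0)"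
      by (intro tendsto_ennrealI tendsto_add tendsto_const LIMSEQ_Suc lim_1_over_n)
    then have "eventually (\<lambda>k. ennreal (l + 1 / Suc k) < f x) sequentially"
      using x by (intro order_tendstoD) auto
    then show "x \<in> (\<Union>k. ?A k)"
      using x eventually_happens[of _ sequentially] by auto
  next
    fix x assume "x \<in> (\<Union>k. ?A k)"
    then obtain k where k: "x \<in> space M" "ennreal (l + 1 / Suc k) < f x" by auto
    moreover have "ennreal l \<le> ennreal (l + 1 / Suc k)" by (intro ennreal_leI) auto
    ultimately show "x \<in> {x \<in> space M. f x > ennreal l}" by auto
  qed
  have inc: "incseq ?A"
  proof (rule incseq_SucI, rule subsetI)
    fix k x assume "x \<in> ?A k"
    moreover have "ennreal (l + 1 / Suc (Suc k)) \<le> ennreal (l + 1 / Suc k)"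
      by (intro ennreal_leI add_left_mono divide_left_mono) auto
    ultimately show "x \<in> ?A (Suc k)" by (auto intro: le_less_trans)
  qed
  have "emeasure M (\<Union>k. ?A k) = (SUP k. emeasure M (?A k))"
    using inc by (intro SUP_emeasure_incseq[symmetric]) auto
  also have "\<dots> \<le> ennreal t" by (intro SUP_least small) auto
  finally show "emeasure M {x \<in> space M. f x > ennreal l} \<le> ennreal t"
    unfolding eq .
next
  assume le: "emeasure M {x \<in> space M. f x > ennreal l} \<le> ennreal t"
  show "rearrangement M f t \<le> ennreal l"
  proof (rule ennreal_le_epsilon)
    fix e :: real assume e: "e > 0"
    have "emeasure M {x \<in> space M. f x > ennreal (l + e)}
        \<le> emeasure M {x \<in> space M. f x > ennreal l}"
    proof (intro emeasure_mono subsetI)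
      fix x assume "x \<in> {x \<in> space M. f x > ennreal (l + e)}"
      moreover have "ennreal l \<le> ennreal (l + e)" using e by (intro ennreal_leI) auto
      ultimately show "x \<in> {x \<in> space M. f x > ennreal l}" by (auto intro: le_less_trans)
    qed auto
    with le have "emeasure M {x \<in> space M. f x > ennreal (l + e)} \<le> ennreal t" by simp
    then have "rearrangement M f t \<le> ennreal (l + e)"
      unfolding rearrangement_def using e l by (intro INF_lower) auto
    then show "rearrangement M f t \<le> ennreal l + ennreal e" using e l by simp
  qed
qed

lemma rearrangement_greater_iff:
  assumes "f \<in> borel_measurable M" and "l \<ge> 0"
  shows "ennreal l < rearrangement M f t
    \<longleftrightarrow> ennreal t < emeasure M {x \<in> space M. f x > ennreal l}"
  using rearrangement_le_iff[OF assms, of t] by (metis not_less)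

lemma rearrangement_antimono: "antimono (rearrangement M f)"
  unfolding rearrangement_def antimono_def
  by (auto intro!: INF_superset_mono intro: order_trans ennreal_leI)

lemma antimono_borel_measurable_ennreal:
  fixes f :: "real \<Rightarrow> ennreal"
  assumes "antimono f"
  shows "f \<in> borel_measurable borel"
proof (rule borel_measurableI_greater)
  fix y
  have "is_interval {x. y < f x}"
    unfolding is_interval_1 using antimonoD[OF assms] by (auto intro: less_le_trans)
  then show "{x \<in> space borel. y < f x} \<in> sets borel"
    using real_interval_borel_measurable by simp
qed

lemma borel_measurable_half_line:
  "f \<in> borel_measurable borel \<Longrightarrow> f \<in> borel_measurable half_line"
  by (simp add: measurable_completion measurable_restrict_space1)

lemma rearrangement_measurable: "rearrangement M f \<in> borel_measurable borel"
  by (intro antimono_borel_measurable_ennreal rearrangement_antimono)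

lemma space_half_line: "space half_line = {0<..}"
  by (simp add: space_restrict_space)

lemma emeasure_half_line:
  "A \<in> sets borel \<Longrightarrow> A \<subseteq> {0<..} \<Longrightarrow> emeasure half_line A = emeasure lborel A"
  by (simp add: emeasure_restrict_space)

lemma emeasure_initial_segment:
  assumes "s \<ge> 0"
  shows "emeasure lborel {t::real. s < t \<and> ennreal (t - s) < m} = m"
proof (cases m)
  case (real r)
  then have "{t::real. s < t \<and> ennreal (t - s) < m} = {s<..<s + r}"
    by (auto simp: ennreal_less_iff)
  then show ?thesis using real by simp
next
  case top
  then have "{t::real. s < t \<and> ennreal (t - s) < m} = {s<..}"
    by auto
  moreover have "emeasure lborel {s<..} = \<infinity>"
  proof (rule ccontr)
    assume fin: "emeasure lborel {s<..} \<noteq> \<infinity>"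
    have "ennreal (real k) \<le> emeasure lborel {s<..}" for k :: nat
    proof -
      have "ennreal (real k) = emeasure lborel {s<..s + real k}" by simp
      also have "\<dots> \<le> emeasure lborel {s<..}" by (intro emeasure_mono) auto
      finally show ?thesis .
    qed
    then show False
      using fin by (metis ennreal_Ex_less_of_nat ennreal_of_nat_eq_real_of_nat infinity_ennreal_def leD top.not_eq_extremum)
  qed
  ultimately show ?thesis using top by simp
qed

text \<open>
  The superlevel sets of the shifted rearrangement are intervals starting at \<open>s\<close> whose length is the
  distribution function of \<open>f\<close>, so all shifts of \<open>f\<^sup>*\<close> to the right are equimeasurable with \<open>f\<^sup>*\<close>.
\<close>

lemma emeasure_rearrangement_shift:
  assumes "f \<in> borel_measurable M" "l \<ge> 0" "s \<ge> 0"
  shows "emeasure half_line {t \<in> space half_line.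
      rearrangement M f (t - s) * indicator {s<..} t > ennreal l}
    = emeasure M {x \<in> space M. f x > ennreal l}"
proof -
  have eq: "{t \<in> space half_line. rearrangement M f (t - s) * indicator {s<..} t > ennreal l}
    = {t. s < t \<and> ennreal (t - s) < emeasure M {x \<in> space M. f x > ennreal l}}"
    using assms rearrangement_greater_iff[OF assms(1,2)]
    by (auto simp: space_half_line indicator_def split: if_splits)
  have "{t. s < t \<and> ennreal (t - s) < m} \<in> sets borel" for m by measurable
  then show ?thesis
    unfolding eq using assms
    by (subst emeasure_half_line) (auto simp: emeasure_initial_segment)
qed

lemma emeasure_rearrangement:
  assumes "f \<in> borel_measurable M" "l \<ge> 0"
  shows "emeasure half_line {t \<in> space half_line. rearrangement M f t > ennreal l}
    = emeasure M {x \<in> space M. f x > ennreal l}"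
proof -
  have "{t \<in> space half_line. rearrangement M f (t - 0) * indicator {0<..} t > ennreal l}
      = {t \<in> space half_line. rearrangement M f t > ennreal l}"
    by (auto simp: space_half_line)
  then show ?thesis
    using emeasure_rearrangement_shift[OF assms, of 0] by simp
qed

section \<open>Averaging over an initial interval\<close>

context ri_function_norm begin

lemma zero: "N (\<lambda>x. 0) = 0"
  by (subst zero_iff) auto

lemma sum_le:
  assumes "\<And>i. i \<in> I \<Longrightarrow> f i \<in> borel_measurable M"
  shows "N (\<lambda>x. \<Sum>i\<in>I. f i x) \<le> (\<Sum>i\<in>I. N (f i))"
  using assms
proof (induction I rule: infinite_finite_induct)
  case (insert i I)
  have "N (\<lambda>x. \<Sum>i\<in>insert i I. f i x) = N (\<lambda>x. f i x + (\<Sum>i\<in>I. f i x))"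
    using insert.hyps by simp
  also have "\<dots> \<le> N (f i) + N (\<lambda>x. \<Sum>i\<in>I. f i x)"
    using insert.prems by (intro triangle) auto
  also have "\<dots> \<le> N (f i) + (\<Sum>i\<in>I. N (f i))"
    using insert by (intro add_left_mono) auto
  finally show ?case using insert.hyps by simp
qed (auto simp: zero)

text \<open>
  Homogeneity is postulated for finite factors only; the infinite factor is reached as a
  supremum of integers.
\<close>

lemma scale_ennreal_le:
  assumes [measurable]: "f \<in> borel_measurable M"
  shows "c * N f \<le> N (\<lambda>x. c * f x)"
proof (cases c)
  case (real r)
  then show ?thesis using scale[of f r] by simp
next
  case top
  have le: "of_nat k * N f \<le> N (\<lambda>x. c * f x)" for k
  proof -
    have "of_nat k * N f = N (\<lambda>x. ennreal (real k) * f x)"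
      by (subst scale) (auto simp: ennreal_of_nat_eq_real_of_nat)
    also have "\<dots> \<le> N (\<lambda>x. c * f x)"
      using top by (intro mono) (auto intro!: mult_right_mono)
    finally show ?thesis .
  qed
  have "c * N f = (SUP k. of_nat k) * N f"
    by (simp add: top ennreal_SUP_of_nat_eq_top)
  also have "\<dots> = (SUP k. of_nat k * N f)"
    by (simp add: SUP_mult_right_ennreal)
  also have "\<dots> \<le> N (\<lambda>x. c * f x)" by (intro SUP_least le)
  finally show ?thesis .
qed

end

definition cell :: "real \<Rightarrow> nat \<Rightarrow> real set" where
  "cell h i = {real i * h<..real (Suc i) * h}"

lemma cell_borel [measurable]: "cell h i \<in> sets borel"
  by (simp add: cell_def)

lemma emeasure_cell: "h > 0 \<Longrightarrow> emeasure lborel (cell h i) = ennreal h"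
  by (simp add: cell_def algebra_simps)

definition cell_index :: "real \<Rightarrow> real \<Rightarrow> nat" where
  "cell_index h t = nat (\<lceil>t / h\<rceil> - 1)"

lemma in_cell_iff:
  assumes "h > 0"
  shows "t \<in> cell h i \<longleftrightarrow> t > 0 \<and> i = cell_index h t"
proof
  assume t: "t \<in> cell h i"
  have "\<lceil>t / h\<rceil> = int i + 1"
    using t assms by (intro ceiling_unique) (auto simp: cell_def field_simps)
  moreover have "t > 0"
    using t assms by (auto simp: cell_def intro: le_less_trans[rotated])
  ultimately show "t > 0 \<and> i = cell_index h t" by (simp add: cell_index_def)
next
  assume t: "t > 0 \<and> i = cell_index h t"
  then have "\<lceil>t / h\<rceil> > 0" using assms by simp
  then have "real i = of_int \<lceil>t / h\<rceil> - 1" using t by (simp add: cell_index_def)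
  then have "real i < t / h" "t / h \<le> real i + 1" by linarith+
  then show "t \<in> cell h i" using assms by (simp add: cell_def field_simps)
qed

lemma cell_index_less_iff:
  assumes "h > 0" "t > 0"
  shows "cell_index h t < k \<longleftrightarrow> t \<le> real k * h"
proof -
  have "\<lceil>t / h\<rceil> > 0" using assms by simp
  then have "cell_index h t < k \<longleftrightarrow> \<lceil>t / h\<rceil> \<le> int k"
    unfolding cell_index_def by linarith
  also have "\<dots> \<longleftrightarrow> t / h \<le> real k" by linarith
  finally show ?thesis using assms by (simp add: field_simps)
qed

definition step_function :: "real \<Rightarrow> nat \<Rightarrow> (nat \<Rightarrow> ennreal) \<Rightarrow> real \<Rightarrow> ennreal" where
  "step_function h k c t = (\<Sum>i<k. c i * indicator (cell h i) t)"

lemma step_function_borel [measurable]: "step_function h k c \<in> borel_measurable borel"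
  unfolding step_function_def by measurable

lemma step_function_eq:
  assumes "h > 0"
  shows "step_function h k c t
    = (if 0 < t \<and> t \<le> real k * h then c (cell_index h t) else 0)"
proof -
  have "step_function h k c t
      = (\<Sum>i<k. if i = cell_index h t then c i * (if t > 0 then 1 else 0) else 0)"
    unfolding step_function_def using in_cell_iff[OF assms]
    by (intro sum.cong) (auto simp: indicator_def)
  also have "\<dots> = (if cell_index h t < k then c (cell_index h t) * (if t > 0 then 1 else 0) else 0)"
    by simp
  finally show ?thesis using cell_index_less_iff[OF assms, of t k] by auto
qed

lemma nn_integral_step_function:
  assumes "h > 0"
  shows "(\<integral>\<^sup>+t. step_function h k c t \<partial>lborel) = ennreal h * (\<Sum>i<k. c i)"
  unfolding step_function_def
  by (subst nn_integral_sum)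
    (auto simp: nn_integral_cmult emeasure_cell[OF assms] sum_distrib_left mult.commute)

lemma bij_betw_add_mod:
  assumes "k > 0"
  shows "bij_betw (\<lambda>i. (i + j) mod k) {..<k} {..<k::nat}"
proof -
  have "inj_on (\<lambda>i. (i + j) mod k) {..<k}"
  proof (rule inj_onI)
    fix x y assume xy: "x \<in> {..<k}" "y \<in> {..<k}" "(x + j) mod k = (y + j) mod k"
    have inverse: "((z + j) mod k + (k - j mod k)) mod k = z" if "z < k" for z
    proof -
      have "j mod k \<le> k" using assms by (simp add: less_imp_le)
      then have "z + j + (k - j mod k) = z + k * Suc (j div k)"
        using mod_mult_div_eq[of j k] by (simp only: mult_Suc_right)
      then have "(z + j + (k - j mod k)) mod k = z"
        using that by (simp only: mod_mult_self2 mod_less)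
      then show ?thesis by (simp only: mod_add_left_eq)
    qed
    from inverse[of x] inverse[of y] xy show "x = y" by (metis lessThan_iff)
  qed
  moreover have "(\<lambda>i. (i + j) mod k) ` {..<k} \<subseteq> {..<k}" using assms by auto
  ultimately show ?thesis
    by (simp add: bij_betw_def endo_inj_surj)
qed

lemma emeasure_step_function_greater:
  assumes "h > 0"
  shows "emeasure half_line {t \<in> space half_line. step_function h k c t > ennreal l}
    = ennreal h * (\<Sum>i<k. if c i > ennreal l then 1 else 0)"
proof -
  have "emeasure half_line {t \<in> space half_line. step_function h k c t > ennreal l}
      = emeasure lborel {t. 0 < t \<and> step_function h k c t > ennreal l}"
  proof -
    have "{t \<in> space half_line. step_function h k c t > ennreal l}
        = {t \<in> space borel. 0 < t \<and> step_function h k c t > ennreal l}"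
      by (auto simp: space_half_line)
    moreover have "{t \<in> space borel. 0 < t \<and> step_function h k c t > ennreal l} \<in> sets borel"
      by measurable
    ultimately show ?thesis by (subst emeasure_half_line) auto
  qed
  also have "\<dots> = (\<integral>\<^sup>+t. indicator {t. 0 < t \<and> step_function h k c t > ennreal l} t \<partial>lborel)"
    by (subst nn_integral_indicator) auto
  also have "\<dots> = (\<integral>\<^sup>+t. step_function h k (\<lambda>i. if c i > ennreal l then 1 else 0) t \<partial>lborel)"
    using assms by (intro nn_integral_cong) (auto simp: step_function_eq indicator_def)
  finally show ?thesis using nn_integral_step_function[OF assms] by simp
qed

text \<open>
  This is the inequality \<open>\<phi>(a) (1/a) \<integral>\<^sub>0\<^sup>a G \<le> \<parallel>G\<parallel>\<close> with the fundamental function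
  \<open>\<phi>(a) = \<parallel>\<chi>\<^bsub>(0,a)\<^esub>\<parallel>\<close>. It is proved without duality. Cut \<open>(0,a]\<close> into \<open>k\<close> equal cells and replace
  \<open>G\<close> by the step function \<open>S\<close> below it. The \<open>k\<close> cyclic permutations of the cells yield functions
  equimeasurable with \<open>S\<close> whose sum is constant on \<open>(0,a]\<close>, so the triangle inequality bounds the norm
  of the averaged \<open>S\<close> by \<open>\<parallel>G\<parallel>\<close>. Because \<open>G\<close> is nonincreasing, the average of \<open>S\<close> dominates
  \<open>1/a\<close> times the integral of \<open>G\<close> over \<open>(a/k, a]\<close>, and monotone convergence concludes.
\<close>

lemma norm_indicator_times_integral_le:
  assumes "ri_function_norm half_line N" and G: "antimono G" and a: "a > 0"
  shows "N (indicator {0<..a}) * (\<integral>\<^sup>+t. G t * indicator {0<..a} t \<partial>lborel) \<le> ennreal a * N G"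
proof -
  interpret ri_function_norm half_line N by fact
  have G_meas [measurable]: "G \<in> borel_measurable borel"
    by (rule antimono_borel_measurable_ennreal[OF G])
  have G_half: "G \<in> borel_measurable half_line" by (rule borel_measurable_half_line) measurable
  have step_half: "step_function h k c \<in> borel_measurable half_line" for h k c
    by (rule borel_measurable_half_line) measurable
  have ind_half: "indicator {0<..a} \<in> borel_measurable half_line"
    by (rule borel_measurable_half_line) measurable
  have truncated: "N (indicator {0<..a}) * (\<integral>\<^sup>+t. G t * indicator {a / real k<..a} t \<partial>lborel)
      \<le> ennreal a * N G" if k: "k > 0" for k :: nat
  proof -
    define h where "h = a / real k"
    have h: "h > 0" and kh: "real k * h = a" using k a by (auto simp: h_def)
    define g where "g i = G (real (Suc i) * h)" for i
    define S where "S j = step_function h k (\<lambda>i. g ((i + j) mod k))" for j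
    have reindex: "(\<Sum>i<k. f ((i + j) mod k)) = (\<Sum>i<k. f i)" for f :: "nat \<Rightarrow> ennreal" and j
      by (rule sum.reindex_bij_betw[OF bij_betw_add_mod[OF k]])
    have S_le: "N (S j) \<le> N G" for j
    proof -
      have "N (S j) = N (step_function h k g)"
      proof (rule rearrangement_invariant)
        show "equimeasurable half_line (S j) (step_function h k g)"
          unfolding equimeasurable_def S_def emeasure_step_function_greater[OF h]
          using reindex[of "\<lambda>i. if ennreal l < g i then 1 else 0" j for l] by simp
      qed (auto simp: S_def step_half)
      also have "\<dots> \<le> N G"
      proof (rule mono)
        have "step_function h k g t \<le> G t" for t
        proof (cases "0 < t \<and> t \<le> real k * h")
          case True
          then have "t \<in> cell h (cell_index h t)" using in_cell_iff[OF h] by blast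
          then have "G (real (Suc (cell_index h t)) * h) \<le> G t"
            using antimonoD[OF G] by (auto simp: cell_def)
          then show ?thesis using True h by (simp add: step_function_eq g_def)
        next
          case False
          then show ?thesis by (auto simp: step_function_eq[OF h])
        qed
        then show "AE t in half_line. step_function h k g t \<le> G t" by simp
      qed (auto simp: step_half G_half)
      finally show ?thesis .
    qed
    have sum_S: "(\<Sum>j<k. S j t) = (\<Sum>i<k. g i) * indicator {0<..a} t" for t
    proof -
      have "(\<Sum>j<k. S j t)
          = (if 0 < t \<and> t \<le> a then \<Sum>j<k. g ((j + cell_index h t) mod k) else 0)"
        by (auto simp: S_def step_function_eq[OF h] kh add.commute)
      then show ?thesis unfolding reindex by (auto simp: indicator_def)
    qed
    have "(\<Sum>i<k. g i) * N (indicator {0<..a}) \<le> N (\<lambda>t. (\<Sum>i<k. g i) * indicator {0<..a} t)"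
      by (rule scale_ennreal_le[OF ind_half])
    also have "\<dots> = N (\<lambda>t. \<Sum>j<k. S j t)" unfolding sum_S ..
    also have "\<dots> \<le> (\<Sum>j<k. N (S j))" by (intro sum_le) (simp add: S_def step_half)
    also have "\<dots> \<le> (\<Sum>j<k. N G)" by (intro sum_mono S_le)
    also have "\<dots> = ennreal (real k) * N G" by (simp add: ennreal_of_nat_eq_real_of_nat)
    finally have N_le: "(\<Sum>i<k. g i) * N (indicator {0<..a}) \<le> ennreal (real k) * N G" .
    (* On a cell G is at most its value at the left endpoint, which is the value of the step
       function on the preceding cell; the first cell, where G may be unbounded, is given up. *)
    have "(\<integral>\<^sup>+t. G t * indicator {a / real k<..a} t \<partial>lborel)
        \<le> (\<integral>\<^sup>+t. step_function h k g (t - h) \<partial>lborel)"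
    proof (rule nn_integral_mono)
      fix t
      show "G t * indicator {a / real k<..a} t \<le> step_function h k g (t - h)"
      proof (cases "h < t \<and> t \<le> a")
        case True
        then have "t - h \<in> cell h (cell_index h (t - h))" using in_cell_iff[OF h] by auto
        then have "G t \<le> g (cell_index h (t - h))"
          unfolding g_def by (intro antimonoD[OF G]) (simp add: cell_def algebra_simps)
        then show ?thesis using True h by (simp add: step_function_eq kh indicator_def)
      qed (auto simp: indicator_def h_def)
    qed
    also have "\<dots> = (\<integral>\<^sup>+t. step_function h k g t \<partial>lborel)"
      using nn_integral_real_affine[of "step_function h k g" 1 "- h"] by simp
    also have "\<dots> = ennreal h * (\<Sum>i<k. g i)" by (rule nn_integral_step_function[OF h])
    finally have "N (indicator {0<..a}) * (\<integral>\<^sup>+t. G t * indicator {a / real k<..a} t \<partial>lborel)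
        \<le> N (indicator {0<..a}) * (ennreal h * (\<Sum>i<k. g i))"
      by (rule mult_left_mono) simp
    also have "\<dots> = ennreal h * ((\<Sum>i<k. g i) * N (indicator {0<..a}))" by (simp add: ac_simps)
    also have "\<dots> \<le> ennreal h * (ennreal (real k) * N G)" by (intro mult_left_mono N_le) simp
    also have "\<dots> = ennreal a * N G"
      using h kh by (simp add: mult.assoc[symmetric] ennreal_mult[symmetric] mult.commute)
    finally show ?thesis .
  qed
  have sup: "(SUP k. G t * indicator {a / real (Suc k)<..a} t) = G t * indicator {0<..a} t" for t
  proof (cases "0 < t \<and> t \<le> a")
    case True
    obtain k where "inverse (real (Suc k)) < t / a"
      using reals_Archimedean[of "t / a"] True a by auto
    then have "a / real (Suc k) < t" using a by (simp add: field_simps)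
    then show ?thesis using True
      by (intro antisym SUP_least SUP_upper2[of k]) (auto simp: indicator_def)
  next
    case False
    moreover have "a / real (Suc k) > 0" for k using a by simp
    ultimately have "indicator {a / real (Suc k)<..a} t = (0::ennreal)" for k
      by (auto simp: indicator_def dest: less_trans)
    then have "(SUP k. G t * indicator {a / real (Suc k)<..a} t) = (SUP k::nat. 0)"
      by (simp only: mult_zero_right)
    then show ?thesis using False by (auto simp: indicator_def)
  qed
  have inc: "incseq (\<lambda>k t. G t * indicator {a / real (Suc k)<..a} t)"
  proof (intro incseq_SucI le_funI mult_left_mono)
    fix k t
    have "a / real (Suc (Suc k)) \<le> a / real (Suc k)" using a by (intro divide_left_mono) auto
    then show "indicator {a / real (Suc k)<..a} t
        \<le> (indicator {a / real (Suc (Suc k))<..a} t :: ennreal)"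
      by (auto simp: indicator_def)
  qed simp
  have "N (indicator {0<..a}) * (\<integral>\<^sup>+t. G t * indicator {0<..a} t \<partial>lborel)
      = N (indicator {0<..a}) * (SUP k. \<integral>\<^sup>+t. G t * indicator {a / real (Suc k)<..a} t \<partial>lborel)"
    unfolding sup[symmetric] by (subst nn_integral_monotone_convergence_SUP[OF inc]) auto
  also have "\<dots> = (SUP k. N (indicator {0<..a})
      * (\<integral>\<^sup>+t. G t * indicator {a / real (Suc k)<..a} t \<partial>lborel))"
    by (simp add: SUP_mult_left_ennreal)
  also have "\<dots> \<le> ennreal a * N G" by (intro SUP_least truncated) simp
  finally show ?thesis .
qed

section \<open>A bathtub principle\<close>

text \<open>
  A weight of height at most \<open>1/a\<close> and mass at most \<open>m\<close> collects from the level set \<open>{f > l}\<close> at most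
  \<open>min (\<mu>{f > l} / a) m\<close>, which is \<open>1/a\<close> times the length of \<open>{f\<^sup>* > l} \<inter> (0, m a]\<close>. Integrating over
  the levels \<open>l\<close> gives the claim.
\<close>

lemma weighted_integral_le_rearrangement:
  assumes "sigma_finite_measure M"
    and [measurable]: "f \<in> borel_measurable M" "w \<in> borel_measurable M"
    and a: "a > 0" and bound: "\<And>x. x \<in> space M \<Longrightarrow> w x \<le> ennreal (1 / a)"
    and mass: "(\<integral>\<^sup>+x. w x \<partial>M) \<le> ennreal m" and m: "m \<ge> 0"
  shows "(\<integral>\<^sup>+x. f x * w x \<partial>M)
    \<le> ennreal (1 / a) * (\<integral>\<^sup>+t. rearrangement M f t * indicator {0<..m * a} t \<partial>lborel)"
proof -
  interpret sigma_finite_measure M by fact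
  interpret P: pair_sigma_finite M "lborel :: real measure" ..
  note [measurable] = rearrangement_measurable
  have layer: "(\<integral>\<^sup>+l. indicator {l. 0 \<le> l \<and> ennreal l < y} l \<partial>lborel) = y" for y
  proof -
    have "AE l in lborel. l \<noteq> (0::real)" by (rule AE_lborel_singleton)
    then have ae: "AE l in lborel. indicator {l. 0 \<le> l \<and> ennreal l < y} l
        = (indicator {l. 0 < l \<and> ennreal (l - 0) < y} l :: ennreal)"
      by eventually_elim (auto simp: indicator_def)
    have "(\<integral>\<^sup>+l. indicator {l. 0 \<le> l \<and> ennreal l < y} l \<partial>lborel)
        = (\<integral>\<^sup>+l. indicator {l. 0 < l \<and> ennreal (l - 0) < y} l \<partial>lborel)"
      by (rule nn_integral_cong_AE[OF ae])
    also have "\<dots> = y" using emeasure_initial_segment[of 0 y] by (subst nn_integral_indicator) auto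
    finally show ?thesis .
  qed
  have level: "(\<integral>\<^sup>+x. indicator {x \<in> space M. ennreal l < f x} x * w x \<partial>M)
      \<le> ennreal (1 / a) * (\<integral>\<^sup>+t. indicator {t. ennreal l < rearrangement M f t} t
          * indicator {0<..m * a} t \<partial>lborel)" (is "?L \<le> ?R") if l: "l \<ge> 0" for l
  proof -
    let ?\<mu> = "emeasure M {x \<in> space M. ennreal l < f x}"
    have "?L \<le> (\<integral>\<^sup>+x. ennreal (1 / a) * indicator {x \<in> space M. ennreal l < f x} x \<partial>M)"
      by (intro nn_integral_mono) (auto simp: indicator_def bound)
    also have "\<dots> = ennreal (1 / a) * ?\<mu>" by (subst nn_integral_cmult_indicator) auto
    finally have L1: "?L \<le> ennreal (1 / a) * ?\<mu>" .
    have "?L \<le> (\<integral>\<^sup>+x. w x \<partial>M)"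
      by (intro nn_integral_mono) (auto simp: indicator_def)
    with mass have L2: "?L \<le> ennreal m" by simp
    have R_eq: "?R = ennreal (1 / a) * emeasure lborel
        ({t. 0 < t \<and> ennreal (t - 0) < ?\<mu>} \<inter> {0<..m * a})"
    proof -
      have "indicator {t. ennreal l < rearrangement M f t} t * indicator {0<..m * a} t
          = (indicator ({t. 0 < t \<and> ennreal (t - 0) < ?\<mu>} \<inter> {0<..m * a}) t :: ennreal)" for t
        using rearrangement_greater_iff[of f M l t] l by (auto simp: indicator_def)
      then show ?thesis by (simp only:) (subst nn_integral_indicator, auto)
    qed
    show ?thesis
    proof (cases "?\<mu> \<le> ennreal (m * a)")
      case True
      have "t \<le> m * a" if "0 < t" "ennreal t < ?\<mu>" for t
        using less_le_trans[OF that(2) True] that(1) by (simp add: ennreal_less_iff)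
      then have "{t. 0 < t \<and> ennreal (t - 0) < ?\<mu>} \<inter> {0<..m * a}
          = {t. 0 < t \<and> ennreal (t - 0) < ?\<mu>}"
        by auto
      then show ?thesis using L1 R_eq emeasure_initial_segment[of 0 ?\<mu>] by simp
    next
      case False
      then have "ennreal t < ?\<mu>" if "t \<le> m * a" for t
        using ennreal_leI[OF that] by simp
      then have "{t. 0 < t \<and> ennreal (t - 0) < ?\<mu>} \<inter> {0<..m * a} = {0<..m * a}"
        by auto
      then have "?R = ennreal (1 / a) * ennreal (m * a)" using R_eq a m by simp
      also have "\<dots> = ennreal m" using a m by (simp add: ennreal_mult[symmetric])
      finally show ?thesis using L2 by simp
    qed
  qed
  have "(\<integral>\<^sup>+x. f x * w x \<partial>M)
      = (\<integral>\<^sup>+x. (\<integral>\<^sup>+l. indicator {l. 0 \<le> l \<and> ennreal l < f x} l \<partial>lborel) * w x \<partial>M)"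
    unfolding layer ..
  also have "\<dots> = (\<integral>\<^sup>+x. (\<integral>\<^sup>+l. indicator {l. 0 \<le> l \<and> ennreal l < f x} l * w x \<partial>lborel) \<partial>M)"
    by (intro nn_integral_cong) (subst nn_integral_multc, auto)
  also have "\<dots> = (\<integral>\<^sup>+l. (\<integral>\<^sup>+x. indicator {l. 0 \<le> l \<and> ennreal l < f x} l * w x \<partial>M) \<partial>lborel)"
    by (rule P.Fubini'[symmetric]) (simp add: indicator_def, measurable)
  also have "\<dots> = (\<integral>\<^sup>+l. indicator {0..} l *
      (\<integral>\<^sup>+x. indicator {x \<in> space M. ennreal l < f x} x * w x \<partial>M) \<partial>lborel)"
    by (intro nn_integral_cong) (auto simp: indicator_def intro!: nn_integral_cong)
  also have "\<dots> \<le> (\<integral>\<^sup>+l. indicator {0..} l * (ennreal (1 / a) *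
      (\<integral>\<^sup>+t. indicator {t. ennreal l < rearrangement M f t} t * indicator {0<..m * a} t \<partial>lborel))
      \<partial>lborel)"
  proof (rule nn_integral_mono)
    fix l show "indicator {0..} l *
        (\<integral>\<^sup>+x. indicator {x \<in> space M. ennreal l < f x} x * w x \<partial>M)
      \<le> indicator {0..} l * (ennreal (1 / a) *
        (\<integral>\<^sup>+t. indicator {t. ennreal l < rearrangement M f t} t * indicator {0<..m * a} t \<partial>lborel))"
      using level[of l] by (cases "l \<ge> 0") simp_all
  qed
  also have "\<dots> = (\<integral>\<^sup>+l. ennreal (1 / a) *
      (\<integral>\<^sup>+t. indicator {l. 0 \<le> l \<and> ennreal l < rearrangement M f t} l
          * indicator {0<..m * a} t \<partial>lborel) \<partial>lborel)"
    by (intro nn_integral_cong) (auto simp: indicator_def intro!: nn_integral_cong)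
  also have "\<dots> = ennreal (1 / a) * (\<integral>\<^sup>+l.
      (\<integral>\<^sup>+t. indicator {l. 0 \<le> l \<and> ennreal l < rearrangement M f t} l
          * indicator {0<..m * a} t \<partial>lborel) \<partial>lborel)"
    by (intro nn_integral_cmult) (simp add: indicator_def, measurable)
  also have "\<dots> = ennreal (1 / a) * (\<integral>\<^sup>+t.
      (\<integral>\<^sup>+l. indicator {l. 0 \<le> l \<and> ennreal l < rearrangement M f t} l
          * indicator {0<..m * a} t \<partial>lborel) \<partial>lborel)"
    by (intro arg_cong2[where f="(*)"] refl lborel_pair.Fubini') (simp add: indicator_def, measurable)
  also have "\<dots> = ennreal (1 / a) * (\<integral>\<^sup>+t. rearrangement M f t * indicator {0<..m * a} t \<partial>lborel)"
    by (intro arg_cong2[where f="(*)"] refl nn_integral_cong)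
      (subst nn_integral_multc, auto simp: layer)
  finally show ?thesis .
qed

section \<open>Radial integration\<close>

text \<open>The surface area of the unit sphere of a Euclidean space of dimension \<open>d\<close> is \<open>d\<close> times the
  volume of the unit ball.\<close>

definition sphere_area :: "'a::euclidean_space itself \<Rightarrow> real" where
  "sphere_area _ = real DIM('a) * unit_ball_vol (real DIM('a))"

lemma sphere_area_pos: "sphere_area TYPE('a::euclidean_space) > 0"
  by (simp add: sphere_area_def)

text \<open>
  Polar coordinates for radial integrands need only the image of Lebesgue measure under the norm. It is
  determined by the volumes of balls.
\<close>

lemma distr_norm_lborel:
  "distr lborel borel (norm :: 'a::euclidean_space \<Rightarrow> real)
    = density lborel (\<lambda>r. ennreal (sphere_area TYPE('a) * r ^ (DIM('a) - 1)) * indicator {0..} r)"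
    (is "?D = ?E")
proof (rule measure_eqI_generator_eq[where E = "range (\<lambda>b. {..b::real})" and \<Omega> = UNIV
      and A = "\<lambda>k. {..real k}"])
  show "Int_stable (range (\<lambda>b. {..b::real}))"
    by (auto simp: Int_stable_def intro!: exI[of _ "min _ _"])
  show "sets ?D = sigma_sets UNIV (range (\<lambda>b. {..b::real}))"
    "sets ?E = sigma_sets UNIV (range (\<lambda>b. {..b::real}))"
    by (simp_all add: borel_eq_atMost)
  show "(\<Union>k. {..real k}) = (UNIV::real set)" using real_arch_simple by auto
  have D: "emeasure ?D {..b} = ennreal (if b \<ge> 0 then unit_ball_vol (real DIM('a)) * b ^ DIM('a) else 0)"
    for b
  proof (cases "b \<ge> 0")
    case True
    have "emeasure ?D {..b} = emeasure lborel (cball (0::'a) b)"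
      by (subst emeasure_distr) (auto intro!: arg_cong[where f="emeasure lborel"] simp: cball_def)
    then show ?thesis using True emeasure_cball[of b "0::'a"] by simp
  next
    case False
    then have "norm -` {..b} \<inter> space lborel = ({}::'a set)"
      using norm_ge_zero by (auto dest: order_trans[OF norm_ge_zero])
    then show ?thesis using False by (subst emeasure_distr) auto
  qed
  have E: "emeasure ?E {..b} = ennreal (if b \<ge> 0 then unit_ball_vol (real DIM('a)) * b ^ DIM('a) else 0)"
    for b
  proof (cases "b \<ge> 0")
    case True
    have "emeasure ?E {..b} = (\<integral>\<^sup>+r. ennreal (sphere_area TYPE('a) * r ^ (DIM('a) - 1))
        * indicator {0..b} r \<partial>lborel)"
      by (subst emeasure_density) (auto intro!: nn_integral_cong simp: indicator_def)
    also have "\<dots> = unit_ball_vol (real DIM('a)) * b ^ DIM('a)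
        - unit_ball_vol (real DIM('a)) * 0 ^ DIM('a)"
      using True sphere_area_pos[where 'a='a]
      by (intro nn_integral_FTC_Icc)
        (auto intro!: derivative_eq_intros simp: sphere_area_def simp flip: has_real_derivative_iff_has_vector_derivative)
    finally show ?thesis using True by (simp add: power_0_left)
  next
    case False
    then show ?thesis
      by (subst emeasure_density) (auto intro!: nn_integral_0_iff_AE[THEN iffD2] simp: indicator_def)
  qed
  show "emeasure ?D X = emeasure ?E X" if "X \<in> range (\<lambda>b. {..b::real})" for X
    using that D E by auto
  show "emeasure ?D {..real k} \<noteq> \<infinity>" for k using D by simp
qed auto

lemma nn_integral_radial:
  assumes [measurable]: "f \<in> borel_measurable borel" and f0: "\<And>r. r \<le> 0 \<Longrightarrow> f r = 0"
  shows "(\<integral>\<^sup>+x. f (norm x) * ennreal (1 / norm (x::'a::euclidean_space) ^ (DIM('a) - 1)) \<partial>lborel)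
    = ennreal (sphere_area TYPE('a)) * (\<integral>\<^sup>+r. f r \<partial>lborel)"
proof -
  let ?d = "DIM('a) - 1" and ?c = "sphere_area TYPE('a)"
  have "(\<integral>\<^sup>+x. f (norm (x::'a)) * ennreal (1 / norm x ^ ?d) \<partial>lborel)
      = (\<integral>\<^sup>+r. f r * ennreal (1 / r ^ ?d) \<partial>distr lborel borel (norm :: 'a \<Rightarrow> real))"
    by (subst nn_integral_distr) auto
  also have "\<dots> = (\<integral>\<^sup>+r. ennreal (?c * r ^ ?d) * indicator {0..} r * (f r * ennreal (1 / r ^ ?d)) \<partial>lborel)"
    unfolding distr_norm_lborel by (subst nn_integral_density) auto
  also have "\<dots> = (\<integral>\<^sup>+r. ennreal ?c * f r \<partial>lborel)"
  proof (rule nn_integral_cong)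
    fix r :: real
    show "ennreal (?c * r ^ ?d) * indicator {0..} r * (f r * ennreal (1 / r ^ ?d)) = ennreal ?c * f r"
    proof (cases "r > 0")
      case True
      then have "ennreal (?c * r ^ ?d) * ennreal (1 / r ^ ?d) = ennreal ?c"
        using sphere_area_pos[where 'a='a] by (subst ennreal_mult[symmetric]) auto
      then show ?thesis using True by (simp add: ac_simps)
    qed (use f0 in simp)
  qed
  also have "\<dots> = ennreal ?c * (\<integral>\<^sup>+r. f r \<partial>lborel)" by (rule nn_integral_cmult) simp
  finally show ?thesis .
qed

lemma
  fixes f :: "real \<Rightarrow> real"
  assumes [measurable]: "f \<in> borel_measurable borel" and f0: "\<And>r. r \<le> 0 \<Longrightarrow> f r = 0"
  shows integral_radial: "(LINT x|lborel. f (norm x) / norm (x::'a::euclidean_space) ^ (DIM('a) - 1))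
      = sphere_area TYPE('a) * (LINT r|lborel. f r)"
    and integrable_radial_iff:
      "integrable lborel (\<lambda>x. f (norm x) / norm (x::'a::euclidean_space) ^ (DIM('a) - 1))
        \<longleftrightarrow> integrable lborel f"
proof -
  let ?d = "DIM('a) - 1" and ?c = "sphere_area TYPE('a)"
  have c: "?c > 0" by (rule sphere_area_pos)
  have dens: "distr lborel borel (norm :: 'a \<Rightarrow> real)
      = density lborel (\<lambda>r. ennreal (?c * r ^ ?d * indicator {0..} r))"
    unfolding distr_norm_lborel by (intro arg_cong[where f="density lborel"]) (auto simp: indicator_def)
  have eq: "(?c * r ^ ?d * indicator {0..} r) *\<^sub>R (f r / r ^ ?d) = ?c * f r" for r
    using f0[of r] by (cases "r > 0") auto
  have nonneg: "AE r in lborel. 0 \<le> ?c * r ^ ?d * indicator {0..} r"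
    using c by (auto simp: indicator_def)
  have "(LINT x|lborel. f (norm (x::'a)) / norm x ^ ?d)
      = (LINT r|distr lborel borel (norm :: 'a \<Rightarrow> real). f r / r ^ ?d)"
    by (subst integral_distr) auto
  also have "\<dots> = (LINT r|lborel. ?c * f r)"
    unfolding dens by (subst integral_density[OF _ _ nonneg]) (auto simp only: eq, measurable)
  finally show "(LINT x|lborel. f (norm (x::'a)) / norm x ^ ?d) = ?c * (LINT r|lborel. f r)" by simp
  have "integrable lborel (\<lambda>x. f (norm (x::'a)) / norm x ^ ?d)
      \<longleftrightarrow> integrable (distr lborel borel (norm :: 'a \<Rightarrow> real)) (\<lambda>r. f r / r ^ ?d)"
    by (subst integrable_distr_eq) auto
  also have "\<dots> \<longleftrightarrow> integrable lborel (\<lambda>r. ?c * f r)"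
    unfolding dens by (subst integrable_density[OF _ _ nonneg]) (auto simp only: eq, measurable)
  also have "\<dots> \<longleftrightarrow> integrable lborel f" using c by simp
  finally show "integrable lborel (\<lambda>x. f (norm (x::'a)) / norm x ^ ?d) \<longleftrightarrow> integrable lborel f" .
qed

lemma AE_norm:
  assumes "AE r in lborel. P r" and [measurable]: "{r. P r} \<in> sets borel"
  shows "AE x in lborel. P (norm (x::'a::euclidean_space))"
proof -
  have "AE r in distr lborel borel (norm :: 'a \<Rightarrow> real). P r"
    unfolding distr_norm_lborel using assms(1) by (subst AE_density) auto
  then show ?thesis by (subst (asm) AE_distr_iff) auto
qed

lemma AE_scale:
  fixes P :: "'a::euclidean_space \<Rightarrow> bool"
  assumes "AE x in lborel. P x" and [measurable]: "{x. P x} \<in> sets borel" and c: "c \<noteq> 0"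
  shows "AE x in lborel. P (c *\<^sub>R x)"
proof -
  have "AE x in density (distr lborel borel (\<lambda>x::'a. 0 + c *\<^sub>R x)) (\<lambda>_. ennreal (\<bar>c\<bar> ^ DIM('a))). P x"
    using assms(1) by (subst (asm) lborel_affine[OF c, of 0]) simp
  then have "AE x in distr lborel borel (\<lambda>x::'a. 0 + c *\<^sub>R x). P x"
    using c by (subst (asm) AE_density) auto
  then show ?thesis by (subst (asm) AE_distr_iff) auto
qed

text \<open>
  The profile \<open>g\<close> of a radially symmetric function is an arbitrary function. To replace it by a Borel
  function, restrict a Borel representative of \<open>u\<close> to a ray: if \<open>Z\<close> is a null set outside which
  \<open>u(x) = g(|x|)\<close>, all dilates of \<open>Z\<close> are null, so by Fubini almost every ray through the origin meets
  \<open>Z\<close> in a null set of radii, and on such a ray the representative agrees with \<open>g\<close> at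
  almost every radius.
\<close>

lemma radial_borel_profile:
  fixes u :: "'a::euclidean_space \<Rightarrow> real"
  assumes u: "u \<in> borel_measurable lebesgue" and g: "AE x in lebesgue. u x = g (norm x)"
  obtains g' where "g' \<in> borel_measurable borel" "AE x in lebesgue. u x = g' (norm x)"
proof -
  obtain u' where [measurable]: "u' \<in> borel_measurable lborel" and u': "AE x in lborel. u x = u' x"
    using completion_ex_borel_measurable_real[OF u] by auto
  have "AE x in lborel. u' x = g (norm x)"
    using g u' unfolding AE_completion_iff by eventually_elim simp
  then obtain Z where Z: "{x \<in> space lborel. \<not> u' x = g (norm x)} \<subseteq> Z" "Z \<in> null_sets lborel"
    by (auto simp: eventually_ae_filter)
  then have [measurable]: "Z \<in> sets borel" by auto
  have notZ: "AE x in lborel. x \<notin> Z" using Z(2) by (rule AE_not_in)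
  have "AE s in (lborel :: real measure). AE x in lborel. s > 0 \<longrightarrow> s *\<^sub>R x \<notin> Z"
  proof (rule AE_I2)
    fix s :: real
    show "AE x in lborel. s > 0 \<longrightarrow> s *\<^sub>R x \<notin> Z"
    proof (cases "s > 0")
      case True
      then show ?thesis using AE_scale[OF notZ, of s] by auto
    qed simp
  qed
  then have "AE x in lborel. AE s in (lborel :: real measure). s > 0 \<longrightarrow> s *\<^sub>R x \<notin> Z"
    by (subst (asm) lborel_pair.AE_commute) measurable
  moreover have "AE x in lborel. x \<noteq> (0::'a)" by (rule AE_lborel_singleton)
  ultimately have "AE x in lborel. x \<noteq> (0::'a) \<and> (AE s in (lborel :: real measure). s > 0 \<longrightarrow> s *\<^sub>R x \<notin> Z)"
    by eventually_elim auto
  then have "\<exists>x. x \<noteq> (0::'a) \<and> (AE s in (lborel :: real measure). s > 0 \<longrightarrow> s *\<^sub>R x \<notin> Z)"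
    by (rule eventually_happens'[rotated]) (simp add: ae_filter_eq_bot_iff)
  then obtain x0 :: 'a where x0: "x0 \<noteq> 0"
    and ray: "AE s in (lborel :: real measure). s > 0 \<longrightarrow> s *\<^sub>R x0 \<notin> Z"
    by blast
  define g' where "g' r = u' ((r / norm x0) *\<^sub>R x0)" for r
  have g'_meas [measurable]: "g' \<in> borel_measurable borel" unfolding g'_def by measurable
  have "AE r in (lborel::real measure). (1 / norm x0) *\<^sub>R r > 0 \<longrightarrow> ((1 / norm x0) *\<^sub>R r) *\<^sub>R x0 \<notin> Z"
    using AE_scale[OF ray, of "1 / norm x0"] x0 by auto
  then have "AE x in lborel. (1 / norm x0) *\<^sub>R norm (x::'a) > 0
      \<longrightarrow> ((1 / norm x0) *\<^sub>R norm x) *\<^sub>R x0 \<notin> Z"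
    by (rule AE_norm) measurable
  moreover have "AE x in lborel. x \<noteq> (0::'a)" by (rule AE_lborel_singleton)
  ultimately have "AE x in lborel. u x = g' (norm x)"
    using notZ u'
  proof eventually_elim
    case (elim x)
    let ?y = "(norm x / norm x0) *\<^sub>R x0"
    have y: "?y \<notin> Z" "norm ?y = norm x" using elim x0 by auto
    have "u x = g (norm x)" using elim Z(1) by auto
    also have "\<dots> = u' ?y"
    proof -
      have "u' z = g (norm z)" if "z \<notin> Z" for z using that Z(1) by auto
      from this[OF y(1)] show ?thesis unfolding y(2) by simp
    qed
    finally show ?case by (simp add: g'_def)
  qed
  then have "AE x in lebesgue. u x = g' (norm x)" by (simp add: AE_completion_iff)
  with g'_meas show ?thesis by (rule that)
qed

text \<open>
  Open sets are countable disjoint unions of open intervals, and finite Borel measures are outer regular.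
\<close>

lemma emeasure_le_if_le_on_intervals:
  fixes M N :: "real measure"
  assumes sets: "sets M = sets borel" "sets N = sets borel"
    and fin: "emeasure M (space M) \<noteq> \<infinity>" "emeasure N (space N) \<noteq> \<infinity>"
    and le: "\<And>p q. p < q \<Longrightarrow> emeasure M {p<..<q} \<le> emeasure N {p<..<q}"
    and E: "E \<in> sets borel"
  shows "emeasure M E \<le> emeasure N E"
proof -
  have union: "emeasure M (\<Union>k. F k) \<le> emeasure N (\<Union>k. F k)"
    if F: "incseq F" "\<And>k. F k \<in> sets borel" "\<And>k. emeasure M (F k) \<le> emeasure N (F k)"
    for F :: "nat \<Rightarrow> real set"
  proof -
    have "emeasure M (\<Union>k. F k) = (SUP k. emeasure M (F k))"
      using F sets by (intro SUP_emeasure_incseq[symmetric]) auto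
    also have "\<dots> \<le> (SUP k. emeasure N (F k))" using F by (intro SUP_mono) auto
    also have "\<dots> = emeasure N (\<Union>k. F k)"
      using F sets by (intro SUP_emeasure_incseq) auto
    finally show ?thesis .
  qed
  have interval: "emeasure M C \<le> emeasure N C" if C: "is_interval C" "open C" for C :: "real set"
  proof -
    obtain a b where "C = {} \<or> C = UNIV \<or> C = {..<b} \<or> C = {..b} \<or> C = {a<..} \<or> C = {a..} \<or>
        C = {a<..<b} \<or> C = {a<..b} \<or> C = {a..<b} \<or> C = {a..b}"
      using is_real_interval[OF C(1)] by blast
    then have "interior C = {} \<or> interior C = UNIV \<or> interior C = {..<b} \<or> interior C = {a<..}
        \<or> interior C = {a<..<b}"
      by (elim disjE) (simp_all add: interior_open)
    then consider "C = {}" | "C = UNIV" | "C = {..<b}" | "C = {a<..}" | "C = {a<..<b}"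
      using interior_open[OF C(2)] by auto
    then show ?thesis
    proof cases
      case 1
      then show ?thesis by simp
    next
      case 2
      have "C = (\<Union>k. {- real (Suc k)<..<real (Suc k)})"
      proof -
        have "\<exists>k. - real (Suc k) < x \<and> x < real (Suc k)" for x
          using reals_Archimedean2[of "\<bar>x\<bar>"] by (smt (verit) of_nat_Suc)
        then show ?thesis using 2 by auto
      qed
      then show ?thesis by (simp only:) (intro union le, auto simp: incseq_def)
    next
      case 3
      have "C = (\<Union>k. {b - real (Suc k)<..<b})"
      proof -
        have "\<exists>k. b - real (Suc k) < x" for x
          using reals_Archimedean2[of "b - x"] by (smt (verit) of_nat_Suc)
        then show ?thesis using 3 by auto
      qed
      then show ?thesis by (simp only:) (intro union le, auto simp: incseq_def)
    next
      case 4
      have "C = (\<Union>k. {a<..<a + real (Suc k)})"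
      proof -
        have "\<exists>k. x < a + real (Suc k)" for x
          using reals_Archimedean2[of "x - a"] by (smt (verit) of_nat_Suc)
        then show ?thesis using 4 by auto
      qed
      then show ?thesis by (simp only:) (intro union le, auto simp: incseq_def)
    next
      case 5
      then show ?thesis using le[of a b] by (cases "a < b") auto
    qed
  qed
  have open_le: "emeasure M U \<le> emeasure N U" if U: "open U" for U :: "real set"
  proof -
    have comp: "open C" "is_interval C" if "C \<in> components U" for C
      using that U open_components in_components_connected is_interval_connected_1 by blast+
    have disj: "disjoint_family_on (\<lambda>C. C) (components U)"
      using pairwise_disjoint_components[of U] by (auto simp: disjoint_family_on_def pairwise_def)
    have cnt: "countable (components U)"
      using pairwise_disjoint_components[of U] comp
      by (intro countable_disjoint_open_subsets) (auto simp: pairwise_def disjnt_def)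
    have U_eq: "U = (\<Union>C\<in>components U. C)" by (simp add: Union_components)
    have "emeasure M U = (\<integral>\<^sup>+C. emeasure M C \<partial>count_space (components U))"
      by (subst U_eq, rule emeasure_UN_countable) (auto simp: sets comp cnt disj)
    also have "\<dots> \<le> (\<integral>\<^sup>+C. emeasure N C \<partial>count_space (components U))"
      by (intro nn_integral_mono) (auto intro: interval comp)
    also have "\<dots> = emeasure N U"
      by (subst U_eq, rule emeasure_UN_countable[symmetric]) (auto simp: sets comp cnt disj)
    finally show ?thesis .
  qed
  have "emeasure M E \<le> (INF U \<in> {U. E \<subseteq> U \<and> open U}. emeasure N U)"
  proof (rule INF_greatest)
    fix U assume "U \<in> {U. E \<subseteq> U \<and> open U}"
    then have "emeasure M E \<le> emeasure M U" "emeasure M U \<le> emeasure N U"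
      using sets open_le by (auto intro: emeasure_mono)
    then show "emeasure M E \<le> emeasure N U" by simp
  qed
  also have "\<dots> = emeasure N E" using outer_regular[OF sets(2) fin(2) E] by simp
  finally show ?thesis .
qed

section \<open>Smooth functions on the line and smooth radial functions\<close>

primrec smooth_upto :: "nat \<Rightarrow> (real \<Rightarrow> real) \<Rightarrow> bool" where
  "smooth_upto 0 f \<longleftrightarrow> continuous_on UNIV f"
| "smooth_upto (Suc k) f \<longleftrightarrow> (\<exists>f'. (\<forall>x. (f has_real_derivative f' x) (at x)) \<and> smooth_upto k f')"

lemma smooth_upto_SucI:
  "(\<And>x. (f has_real_derivative f' x) (at x)) \<Longrightarrow> smooth_upto k f' \<Longrightarrow> smooth_upto (Suc k) f"
  by auto

lemma smooth_upto_Suc_imp: "smooth_upto (Suc k) f \<Longrightarrow> smooth_upto k f"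
proof (induction k arbitrary: f)
  case 0
  then show ?case by (auto intro: DERIV_continuous_on)
next
  case (Suc k)
  then show ?case by (metis smooth_upto.simps(2))
qed

lemma smooth_upto_imp_continuous: "smooth_upto k f \<Longrightarrow> continuous_on UNIV f"
  by (induction k arbitrary: f) (auto intro: DERIV_continuous_on)

lemma smooth_upto_const: "smooth_upto k (\<lambda>_. c)"
  by (induction k arbitrary: c) (auto intro!: exI[of _ "\<lambda>_. 0"])

lemma smooth_upto_add:
  "smooth_upto k f \<Longrightarrow> smooth_upto k g \<Longrightarrow> smooth_upto k (\<lambda>x. f x + g x)"
proof (induction k arbitrary: f g)
  case (Suc k)
  then obtain f' g' where "\<forall>x. (f has_real_derivative f' x) (at x)" "smooth_upto k f'"
    "\<forall>x. (g has_real_derivative g' x) (at x)" "smooth_upto k g'" by auto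
  then show ?case
    using Suc.IH[of f' g'] by (auto intro!: exI[of _ "\<lambda>x. f' x + g' x"] DERIV_add)
qed (auto intro: continuous_intros)

lemma smooth_upto_mult:
  "smooth_upto k f \<Longrightarrow> smooth_upto k g \<Longrightarrow> smooth_upto k (\<lambda>x. f x * g x)"
proof (induction k arbitrary: f g)
  case (Suc k)
  then obtain f' g' where d: "\<forall>x. (f has_real_derivative f' x) (at x)" "smooth_upto k f'"
    "\<forall>x. (g has_real_derivative g' x) (at x)" "smooth_upto k g'" by auto
  have "smooth_upto k (\<lambda>x. f' x * g x + g' x * f x)"
    using d Suc smooth_upto_Suc_imp[of k] by (intro smooth_upto_add Suc.IH) auto
  then show ?case
    using d by (auto intro!: exI[of _ "\<lambda>x. f' x * g x + g' x * f x"] DERIV_mult)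
qed (auto intro: continuous_intros)

lemma smooth_upto_diff:
  "smooth_upto k f \<Longrightarrow> smooth_upto k g \<Longrightarrow> smooth_upto k (\<lambda>x. f x - g x)"
  using smooth_upto_add[of k f "\<lambda>x. (-1) * g x"] smooth_upto_mult[OF smooth_upto_const, of k g "-1"]
  by simp

lemma smooth_upto_affine:
  "smooth_upto k f \<Longrightarrow> smooth_upto k (\<lambda>x. f (c * x + d))"
proof (induction k arbitrary: f)
  case (Suc k)
  then obtain f' where d: "\<forall>x. (f has_real_derivative f' x) (at x)" "smooth_upto k f'" by auto
  have "((\<lambda>x. f (c * x + d)) has_real_derivative f' (c * x + d) * c) (at x)" for x
    using d(1) by (intro DERIV_chain2[where f=f]) (auto intro!: derivative_eq_intros)
  moreover have "smooth_upto k (\<lambda>x. f' (c * x + d) * c)"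
    using d Suc.IH by (intro smooth_upto_mult smooth_upto_const) auto
  ultimately show ?case by (rule smooth_upto_SucI)
next
  case 0
  then show ?case
    by (auto intro!: continuous_on_compose2[where f="\<lambda>x. c * x + d" and g=f] continuous_intros)
qed

lemma DERIV_zero_if_vanishing_nearby:
  fixes f :: "real \<Rightarrow> real"
  assumes "(f has_real_derivative D) (at x)" and "\<And>y. y < \<delta> \<Longrightarrow> f y = 0" and "x < \<delta>"
  shows "D = 0"
proof -
  have "((\<lambda>_. 0) has_real_derivative D) (at x)"
    by (rule has_field_derivative_transform_within_open[OF assms(1), of "{..<\<delta>}"])
      (use assms in auto)
  then show ?thesis using DERIV_unique DERIV_const by blast
qed

lemma DERIV_vanishing_nearby:
  fixes f :: "real \<Rightarrow> real"
  assumes "\<And>y. y < \<delta> \<Longrightarrow> f y = 0" and "x < \<delta>"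
  shows "(f has_real_derivative 0) (at x)"
  by (rule has_field_derivative_transform_within_open[of "\<lambda>_. 0" _ _ "{..<\<delta>}"])
    (use assms in auto)

text \<open>
  Functions vanishing near \<open>0\<close> and to its left stay smooth when divided by powers of the variable. This
  is what keeps radial functions smooth at the origin.
\<close>

lemma DERIV_divide_power:
  fixes f :: "real \<Rightarrow> real"
  assumes d: "\<And>x. (f has_real_derivative f' x) (at x)" and \<delta>: "\<delta> > 0"
    and zero: "\<And>x. x < \<delta> \<Longrightarrow> f x = 0"
  shows "((\<lambda>x. f x / x ^ j) has_real_derivative f' x / x ^ j - real j * (f x / x ^ Suc j)) (at x)"
proof (cases "x < \<delta>")
  case True
  have "f' x = 0" using DERIV_zero_if_vanishing_nearby[OF d zero True] by auto
  then show ?thesis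
    using DERIV_vanishing_nearby[of \<delta> "\<lambda>x. f x / x ^ j" x] zero True by simp
next
  case False
  then have x: "x \<noteq> 0" using \<delta> by auto
  have "((\<lambda>x. f x / x ^ j) has_real_derivative
      (f' x * x ^ j - f x * (real j * x ^ (j - 1))) / (x ^ j * x ^ j)) (at x)"
    using x by (auto intro!: derivative_eq_intros d)
  also have "(f' x * x ^ j - f x * (real j * x ^ (j - 1))) / (x ^ j * x ^ j)
      = f' x / x ^ j - real j * (f x / x ^ Suc j)"
  proof -
    have "f x * (real j * x ^ (j - 1)) / (x ^ j * x ^ j) = real j * (f x / x ^ Suc j)"
      using x by (cases j) simp_all
    moreover have "f' x * x ^ j / (x ^ j * x ^ j) = f' x / x ^ j" using x by simp
    ultimately show ?thesis by (simp only: diff_divide_distrib)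
  qed
  finally show ?thesis .
qed

lemma smooth_upto_divide_power:
  assumes "smooth_upto k f" and "\<delta> > 0" and "\<And>x. x < \<delta> \<Longrightarrow> f x = 0"
  shows "smooth_upto k (\<lambda>x. f x / x ^ j)"
  using assms
proof (induction k arbitrary: f j)
  case 0
  have "isCont (\<lambda>x. f x / x ^ j) x" for x
  proof (cases "x < \<delta>")
    case True
    then show ?thesis
      using 0 by (intro DERIV_isCont[OF DERIV_vanishing_nearby[where \<delta>=\<delta>]]) auto
  next
    case False
    then show ?thesis
      using 0 by (intro continuous_intros) (auto simp: continuous_on_eq_continuous_at)
  qed
  then show ?case by (auto intro: continuous_at_imp_continuous_on)
next
  case (Suc k)
  then obtain f' where d: "\<And>x. (f has_real_derivative f' x) (at x)" "smooth_upto k f'" by auto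
  have f'0: "f' x = 0" if "x < \<delta>" for x
    using DERIV_zero_if_vanishing_nearby[OF d(1) Suc.prems(3) that] by auto
  have "((\<lambda>x. f x / x ^ j) has_real_derivative f' x / x ^ j - real j * (f x / x ^ Suc j)) (at x)" for x
    using d(1) Suc.prems(2,3) by (rule DERIV_divide_power)
  moreover have "smooth_upto k (\<lambda>x. f' x / x ^ j - real j * (f x / x ^ Suc j))"
    using Suc.prems(2,3) d(2) f'0 smooth_upto_Suc_imp[OF Suc.prems(1)]
    by (intro smooth_upto_diff smooth_upto_mult smooth_upto_const Suc.IH) blast+
  ultimately show ?case by (rule smooth_upto_SucI)
qed

text \<open>
  The classical smooth function \<open>e\<^bsup>-1/s\<^esup>\<close>, multiplied by \<open>s\<^bsup>-k\<^esup>\<close> so that the family is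
  closed under differentiation up to linear combinations.
\<close>

definition exp_decay :: "nat \<Rightarrow> real \<Rightarrow> real" where
  "exp_decay k s = (if s > 0 then exp (- 1 / s) / s ^ k else 0)"

lemma tendsto_exp_decay_0: "(exp_decay k \<longlongrightarrow> 0) (at 0)"
proof -
  have "((\<lambda>y. y ^ k / exp y) \<longlongrightarrow> (0::real)) at_top" by (rule tendsto_power_div_exp_0)
  then have "((\<lambda>h. inverse h ^ k / exp (inverse h)) \<longlongrightarrow> (0::real)) (at_right 0)"
    by (rule filterlim_compose[OF _ filterlim_inverse_at_top_right])
  then have "(exp_decay k \<longlongrightarrow> 0) (at_right 0)"
    by (rule Lim_transform_eventually)
      (auto simp: exp_decay_def eventually_at_filter exp_minus field_simps)
  moreover have "(exp_decay k \<longlongrightarrow> 0) (at_left 0)"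
    by (rule Lim_transform_eventually[OF tendsto_const])
      (auto simp: exp_decay_def eventually_at_filter)
  ultimately show ?thesis by (simp add: filterlim_split_at)
qed

lemma DERIV_exp_decay:
  "(exp_decay k has_real_derivative exp_decay (k + 2) s - real k * exp_decay (Suc k) s) (at s)"
proof -
  consider "s < 0" | "s = 0" | "s > 0" by linarith
  then show ?thesis
  proof cases
    case 1
    then show ?thesis
      using DERIV_vanishing_nearby[of 0 "exp_decay k" s] by (simp add: exp_decay_def)
  next
    case 2
    have "((\<lambda>h. (exp_decay k (0 + h) - exp_decay k 0) / h) \<longlongrightarrow> 0) (at 0)"
      by (rule Lim_transform_eventually[OF tendsto_exp_decay_0[of "Suc k"]])
        (auto simp: exp_decay_def eventually_at_filter field_simps)
    then show ?thesis using 2 by (simp add: DERIV_def exp_decay_def)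
  next
    case 3
    have "((\<lambda>s. exp (- 1 / s) / s ^ k) has_real_derivative
        exp_decay (k + 2) s - real k * exp_decay (Suc k) s) (at s)"
      using 3 by (auto intro!: derivative_eq_intros simp: exp_decay_def)
        (cases k; auto simp: field_simps power2_eq_square)
    then show ?thesis
      by (rule has_field_derivative_transform_within_open[of _ _ _ "{0<..}"])
        (use 3 in \<open>auto simp: exp_decay_def\<close>)
  qed
qed

lemma smooth_upto_exp_decay: "smooth_upto n (exp_decay k)"
proof (induction n arbitrary: k)
  case 0
  show ?case unfolding smooth_upto.simps
    by (rule DERIV_continuous_on[OF DERIV_exp_decay])
next
  case (Suc n)
  have "smooth_upto n (\<lambda>s. exp_decay (k + 2) s - real k * exp_decay (Suc k) s)"
    by (intro smooth_upto_diff smooth_upto_mult smooth_upto_const Suc.IH)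
  with DERIV_exp_decay show ?case by (rule smooth_upto_SucI)
qed

text \<open>
  Smooth bumps on \<open>(p,q)\<close> with values in \<open>[0,1]\<close>. Dilating the argument of \<open>e\<^bsup>-1/s\<^esup>\<close> by \<open>m + 1\<close>
  makes them converge to the indicator of \<open>(p,q)\<close> without any convolution.
\<close>

definition bump :: "nat \<Rightarrow> real \<Rightarrow> real \<Rightarrow> real \<Rightarrow> real" where
  "bump m p q s = exp_decay 0 ((s - p) * Suc m) * exp_decay 0 ((q - s) * Suc m)"

lemma smooth_upto_bump: "smooth_upto k (bump m p q)"
proof -
  have "smooth_upto k (\<lambda>s. exp_decay 0 (real (Suc m) * s + (- p * Suc m))
      * exp_decay 0 ((- real (Suc m)) * s + q * Suc m))"
    by (intro smooth_upto_mult smooth_upto_affine smooth_upto_exp_decay)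
  then show ?thesis unfolding bump_def by (simp add: algebra_simps)
qed

lemma bump_zero: "\<not> (p < s \<and> s < q) \<Longrightarrow> bump m p q s = 0"
  by (auto simp: bump_def exp_decay_def zero_less_mult_iff)

lemma bump_pos: "p < s \<Longrightarrow> s < q \<Longrightarrow> bump m p q s > 0"
  by (auto simp: bump_def exp_decay_def)

lemma bump_nonneg: "bump m p q s \<ge> 0"
  by (auto simp: bump_def exp_decay_def)

lemma bump_le_1: "bump m p q s \<le> 1"
  unfolding bump_def by (intro mult_le_one) (auto simp: exp_decay_def)

lemma bump_tendsto_indicator: "(\<lambda>m. bump m p q s) \<longlonglongrightarrow> indicator {p<..<q} s"
proof (cases "p < s \<and> s < q")
  case True
  have lim: "(\<lambda>m. exp_decay 0 (d * Suc m)) \<longlonglongrightarrow> 1" if "d > 0" for d :: real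
  proof -
    have "(\<lambda>m. exp (- 1 / d * (1 / Suc m))) \<longlonglongrightarrow> exp (- 1 / d * 0)"
      by (intro tendsto_intros LIMSEQ_Suc[OF lim_1_over_n])
    moreover have "exp_decay 0 (d * Suc m) = exp (- 1 / d * (1 / Suc m))" for m
      using that by (simp add: exp_decay_def zero_less_mult_iff)
    ultimately show ?thesis by simp
  qed
  show ?thesis
    using tendsto_mult[OF lim[of "s - p"] lim[of "q - s"]] True by (simp add: bump_def)
qed (simp add: bump_zero)

lemma bump_borel [measurable]: "bump m p q \<in> borel_measurable borel"
  using smooth_upto_imp_continuous[OF smooth_upto_bump] by (rule borel_measurable_continuous_onI)

lemma partial_deriv_eqI:
  "(f has_derivative D) (at x) \<Longrightarrow> partial_deriv i f x = D (axis i 1)"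
  unfolding partial_deriv_def using frechet_derivative_at by metis

lemma has_derivative_frechet:
  "f differentiable (at x) \<Longrightarrow> (f has_derivative frechet_derivative f (at x)) (at x)"
  by (simp add: frechet_derivative_works)

lemma Ck_Suc_imp: "Ck (Suc k) f \<Longrightarrow> Ck k f"
proof (induction k arbitrary: f)
  case 0
  then show ?case
    by (auto intro!: continuous_at_imp_continuous_on differentiable_imp_continuous_within)
qed (metis Ck.simps(2))

lemma Ck_imp_continuous: "Ck k f \<Longrightarrow> continuous_on UNIV f"
  by (induction k)
    (auto intro!: continuous_at_imp_continuous_on differentiable_imp_continuous_within)

lemma Ck_const: "Ck k (\<lambda>_::real^'n. c)"
proof (induction k arbitrary: c)
  case (Suc k)
  have "partial_deriv i (\<lambda>_. c) = (\<lambda>_. 0)" for i :: 'n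
    by (intro ext) (subst partial_deriv_eqI[OF has_derivative_const], simp)
  then show ?case using Suc by simp
qed simp

lemma Ck_coordinate: "Ck k (\<lambda>x::real^'n. x $ j)"
proof (cases k)
  case (Suc m)
  have D: "((\<lambda>x. x $ j) has_derivative (\<lambda>x. x $ j)) (at x)" for x :: "real^'n"
    by (rule bounded_linear_imp_has_derivative[OF bounded_linear_vec_nth])
  have "partial_deriv i (\<lambda>x. x $ j) = (\<lambda>_. axis i 1 $ j)" for i :: 'n
    by (intro ext) (subst partial_deriv_eqI[OF D], simp)
  then show ?thesis using D Suc by (auto simp: Ck_const differentiable_def)
qed (auto intro: continuous_intros)

lemma Ck_add: "Ck k f \<Longrightarrow> Ck k g \<Longrightarrow> Ck k (\<lambda>x. f x + g x)"
proof (induction k arbitrary: f g)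
  case (Suc k)
  then have d: "\<And>x. f differentiable (at x)" "\<And>x. g differentiable (at x)" by auto
  have "partial_deriv i (\<lambda>x. f x + g x) = (\<lambda>x. partial_deriv i f x + partial_deriv i g x)" for i
  proof
    fix x
    show "partial_deriv i (\<lambda>x. f x + g x) x = partial_deriv i f x + partial_deriv i g x"
      using partial_deriv_eqI[OF has_derivative_add[OF has_derivative_frechet[OF d(1)]
          has_derivative_frechet[OF d(2)]], of i x] by (simp add: partial_deriv_def)
  qed
  then show ?case using Suc d by (auto intro: differentiable_add)
qed (auto intro: continuous_intros)

lemma Ck_mult: "Ck k f \<Longrightarrow> Ck k g \<Longrightarrow> Ck k (\<lambda>x. f x * g x)"
proof (induction k arbitrary: f g)
  case (Suc k)
  then have d: "\<And>x. f differentiable (at x)" "\<And>x. g differentiable (at x)" by auto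
  have p: "partial_deriv i (\<lambda>x. f x * g x)
      = (\<lambda>x. f x * partial_deriv i g x + partial_deriv i f x * g x)" for i
  proof
    fix x
    show "partial_deriv i (\<lambda>x. f x * g x) x = f x * partial_deriv i g x + partial_deriv i f x * g x"
      using partial_deriv_eqI[OF has_derivative_mult[OF has_derivative_frechet[OF d(1)]
          has_derivative_frechet[OF d(2)]], of i x] by (simp add: partial_deriv_def)
  qed
  have "Ck k f" "Ck k g" using Suc.prems by (auto intro: Ck_Suc_imp simp del: Ck.simps)
  then show ?case using Suc d unfolding Ck.simps p
    by (auto intro!: differentiable_mult Ck_add Suc.IH)
qed (auto intro: continuous_intros)

lemma has_derivative_radial:
  fixes f :: "real \<Rightarrow> real" and x :: "'a::euclidean_space"
  assumes d: "(f has_real_derivative f' (norm x)) (at (norm x))"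
    and "\<delta> > 0" and z: "\<And>r. r < \<delta> \<Longrightarrow> f r = 0" and z': "\<And>r. r < \<delta> \<Longrightarrow> f' r = 0"
  shows "((\<lambda>x. f (norm x)) has_derivative (\<lambda>h. f' (norm x) / norm x * (x \<bullet> h))) (at x)"
proof (cases "x = 0")
  case True
  have "((\<lambda>x::'a. f (norm x)) has_derivative (\<lambda>h. 0)) (at x)"
    by (rule has_derivative_transform_within_open[of "\<lambda>_. 0" _ _ _ "ball 0 \<delta>"])
      (use True z \<open>\<delta> > 0\<close> in auto)
  then show ?thesis using True by simp
next
  case False
  have "(norm has_derivative (\<lambda>h. (x \<bullet> h) / norm x)) (at x)"
    using has_derivative_norm[OF False] by (simp add: sgn_div_norm inner_commute divide_inverse_commute)
  then have "((\<lambda>x. f (norm x)) has_derivative (\<lambda>h. f' (norm x) * ((x \<bullet> h) / norm x))) (at x)"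
    using d unfolding has_field_derivative_def by (rule has_derivative_compose)
  then show ?thesis by simp
qed

text \<open>
  The partial derivatives of \<open>f(|x|)\<close> are \<open>x\<^sub>i\<close> times the radial function with profile \<open>f'(r)/r\<close>, which
  again vanishes near \<open>0\<close>; so the induction on the order stays within this class.
\<close>

lemma Ck_radial:
  assumes "smooth_upto k f" and "\<delta> > 0" and "\<And>r. r < \<delta> \<Longrightarrow> f r = 0"
  shows "Ck k (\<lambda>x::real^'n. f (norm x))"
  using assms
proof (induction k arbitrary: f)
  case 0
  then show ?case
    by (auto intro!: continuous_on_compose2[where f=norm and g=f] continuous_intros)
next
  case (Suc k)
  then obtain f' where d: "\<And>x. (f has_real_derivative f' x) (at x)" "smooth_upto k f'" by auto
  have f'0: "f' x = 0" if "x < \<delta>" for x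
    using DERIV_zero_if_vanishing_nearby[OF d(1) Suc.prems(3) that] by auto
  have D: "((\<lambda>x. f (norm x)) has_derivative (\<lambda>h. f' (norm x) / norm x * (x \<bullet> h))) (at x)"
    for x :: "real^'n"
    using d(1) Suc.prems f'0 by (intro has_derivative_radial) auto
  have "partial_deriv i (\<lambda>x. f (norm x)) = (\<lambda>x::real^'n. f' (norm x) / norm x ^ 1 * x $ i)" for i
    by (intro ext) (subst partial_deriv_eqI[OF D], simp add: inner_axis)
  moreover have "Ck k (\<lambda>x::real^'n. f' (norm x) / norm x ^ 1 * x $ i)" for i
  proof (rule Ck_mult)
    show "Ck k (\<lambda>x::real^'n. f' (norm x) / norm x ^ 1)"
      using Suc.IH[OF smooth_upto_divide_power[OF d(2) Suc.prems(2) f'0, of 1]]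
        Suc.prems f'0 by simp
  qed (rule Ck_coordinate)
  ultimately show ?case using D by (auto simp: differentiable_def)
qed

section \<open>The weak gradient of a radial function\<close>

lemma integrable_mult_locally_integrable:
  fixes f :: "real^'n \<Rightarrow> 'b::euclidean_space" and h :: "real^'n \<Rightarrow> real"
  assumes f: "locally_integrable f" and h [measurable]: "h \<in> borel_measurable lebesgue"
    and bound: "\<And>x. \<bar>h x\<bar> \<le> C" and supp: "\<And>x. norm x > P \<Longrightarrow> h x = 0"
  shows "integrable lebesgue (\<lambda>x. h x *\<^sub>R f x)"
proof -
  have [measurable]: "f \<in> borel_measurable lebesgue"
    using f by (simp add: locally_integrable_def)
  have "integrable lebesgue (\<lambda>x. indicator (cball 0 P) x *\<^sub>R f x)"
    using f by (simp add: locally_integrable_def set_integrable_def)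
  then have "integrable lebesgue (\<lambda>x. C *\<^sub>R (indicator (cball 0 P) x *\<^sub>R f x))"
    by (rule integrable_scaleR_right)
  then show ?thesis
  proof (rule Bochner_Integration.integrable_bound)
    have "norm (h x *\<^sub>R f x) \<le> norm (C *\<^sub>R (indicator (cball 0 P) x *\<^sub>R f x))" for x
    proof (cases "norm x \<le> P")
      case True
      then show ?thesis using bound[of x] by (auto intro!: mult_right_mono)
    qed (simp add: supp)
    then show "AE x in lebesgue. norm (h x *\<^sub>R f x)
        \<le> norm (C *\<^sub>R (indicator (cball 0 P) x *\<^sub>R f x))" by simp
  qed measurable
qed

lemma integrable_continuous_mult_locally_integrable:
  fixes f :: "real^'n \<Rightarrow> 'b::euclidean_space" and h :: "real^'n \<Rightarrow> real"
  assumes "locally_integrable f" and h: "continuous_on UNIV h"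
    and supp: "\<And>x. norm x > P \<Longrightarrow> h x = 0"
  shows "integrable lebesgue (\<lambda>x. h x *\<^sub>R f x)"
proof -
  have "compact (h ` cball 0 P)"
    by (intro compact_continuous_image continuous_on_subset[OF h]) auto
  then obtain C where C: "\<And>y. y \<in> h ` cball 0 P \<Longrightarrow> norm y \<le> C"
    using compact_imp_bounded bounded_iff by metis
  have "\<bar>h x\<bar> \<le> max C 0" for x
    using C[of "h x"] supp[of x] by (cases "norm x \<le> P") auto
  moreover have "h \<in> borel_measurable lebesgue"
    using h by (intro measurable_completion) (simp add: borel_measurable_continuous_onI)
  ultimately show ?thesis
    using assms by (intro integrable_mult_locally_integrable) auto
qed

text \<open>
  Test the weak gradient with the components of the vector field \<open>x \<eta>(|x|) / |x|\<^sup>n\<close>. The field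
  \<open>x / |x|\<^sup>n\<close> is divergence-free away from the origin, so only the derivative of \<open>\<eta>\<close> survives in the
  divergence \<open>\<eta>'(|x|) |x|\<^bsup>1-n\<^esup>\<close>. In polar coordinates this is the one-dimensional integration by
  parts for the profile of \<open>u\<close> with the factor \<open>r\<^bsup>n-1\<^esup>\<close> cancelled.
\<close>

lemma weak_gradient_radial_test:
  fixes u :: "real^'n \<Rightarrow> real"
  assumes weak: "has_weak_gradient u v"
    and d: "\<And>r. (\<eta> has_real_derivative \<eta>' r) (at r)" and smooth: "\<And>k. smooth_upto k \<eta>"
    and \<delta>: "\<delta> > 0" "\<And>r. r < \<delta> \<Longrightarrow> \<eta> r = 0" and P: "\<And>r. r > P \<Longrightarrow> \<eta> r = 0"
  shows "(LINT x|lebesgue. u x * (\<eta>' (norm x) / norm x ^ (CARD('n) - 1)))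
    = - (LINT x|lebesgue. (v x \<bullet> x) * (\<eta> (norm x) / norm x ^ CARD('n)))"
proof -
  let ?n = "CARD('n)"
  have \<eta>'0: "\<eta>' r = 0" if "r < \<delta>" for r
    using DERIV_zero_if_vanishing_nearby[OF d \<delta>(2) that] by auto
  have \<eta>'P: "\<eta>' r = 0" if "r > P" for r
  proof -
    have "((\<lambda>_. 0) has_real_derivative \<eta>' r) (at r)"
      by (rule has_field_derivative_transform_within_open[OF d, of "{P<..}"]) (use P that in auto)
    then show ?thesis using DERIV_unique DERIV_const by blast
  qed
  define \<psi> where "\<psi> r = \<eta> r / r ^ ?n" for r
  define \<psi>' where "\<psi>' r = \<eta>' r / r ^ ?n - real ?n * (\<eta> r / r ^ Suc ?n)" for r
  have \<psi>_smooth: "smooth_upto k \<psi>" for k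
    unfolding \<psi>_def using smooth \<delta> by (rule smooth_upto_divide_power)
  have \<psi>_deriv: "(\<psi> has_real_derivative \<psi>' r) (at r)" for r
    unfolding \<psi>_def \<psi>'_def using d \<delta> by (rule DERIV_divide_power)
  have \<psi>_zero: "\<psi> r = 0" "\<psi>' r = 0" if "r < \<delta>" for r
    using that \<delta> \<eta>'0 by (simp_all add: \<psi>_def \<psi>'_def)
  define \<phi> where "\<phi> i x = x $ i * \<psi> (norm x)" for i and x :: "real^'n"
  have \<phi>_Ck: "Ck k (\<phi> i)" for k i
    unfolding \<phi>_def
    by (intro Ck_mult Ck_coordinate Ck_radial[OF \<psi>_smooth \<delta>(1)] \<psi>_zero)
  have \<phi>_supp: "\<phi> i x = 0" if "norm x > P" for i x
    using that P by (simp add: \<phi>_def \<psi>_def)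
  have test: "test_function (\<phi> i)" for i
  proof -
    have "{x. \<phi> i x \<noteq> 0} \<subseteq> cball 0 P" using \<phi>_supp by (auto simp: not_less[symmetric])
    then have "bounded {x. \<phi> i x \<noteq> 0}" using bounded_subset bounded_cball by blast
    then show ?thesis using \<phi>_Ck by (simp add: test_function_def)
  qed
  have pd: "partial_deriv i (\<phi> i) x = \<psi> (norm x) + x $ i * (\<psi>' (norm x) / norm x * x $ i)" for i x
  proof -
    have "((\<lambda>x. \<psi> (norm x)) has_derivative (\<lambda>h. \<psi>' (norm x) / norm x * (x \<bullet> h))) (at x)"
      using \<psi>_deriv \<delta>(1) \<psi>_zero by (intro has_derivative_radial) auto
    from partial_deriv_eqI[OF has_derivative_mult[OF
        bounded_linear_imp_has_derivative[OF bounded_linear_vec_nth] this], of i i]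
    show ?thesis by (simp add: \<phi>_def[abs_def] inner_axis algebra_simps)
  qed
  have pd_cont: "continuous_on UNIV (partial_deriv i (\<phi> i))" for i
    using \<phi>_Ck[of 1 i] by simp
  have pd_supp: "partial_deriv i (\<phi> i) x = 0" if "norm x > P" for i x
    using that P \<eta>'P by (simp add: pd \<psi>_def \<psi>'_def)
  have loc: "locally_integrable u" "locally_integrable v"
    using weak by (auto simp: has_weak_gradient_def)
  have int_u: "integrable lebesgue (\<lambda>x. u x * partial_deriv i (\<phi> i) x)" for i
    using integrable_continuous_mult_locally_integrable[OF loc(1) pd_cont pd_supp]
    by (simp add: mult.commute)
  have int_v: "integrable lebesgue (\<lambda>x. v x $ i * \<phi> i x)" for i
  proof -
    have "integrable lebesgue (\<lambda>x. \<phi> i x *\<^sub>R v x)"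
      by (rule integrable_continuous_mult_locally_integrable[OF loc(2) _ \<phi>_supp])
        (rule Ck_imp_continuous[OF \<phi>_Ck[of 0]])
    from integrable_bounded_linear[OF bounded_linear_vec_nth this, of i]
    show ?thesis by (simp add: mult.commute)
  qed
  have div: "(\<Sum>i\<in>UNIV. partial_deriv i (\<phi> i) x) = \<eta>' (norm x) / norm x ^ (?n - 1)" for x
  proof -
    let ?r = "norm x"
    have sq: "(\<Sum>i\<in>UNIV. x $ i * x $ i) = ?r * ?r"
    proof -
      have "(\<Sum>i\<in>UNIV. x $ i * x $ i) = x \<bullet> x" by (simp add: inner_vec_def)
      then show ?thesis by (simp add: dot_square_norm power2_eq_square)
    qed
    have "(\<Sum>i\<in>UNIV. partial_deriv i (\<phi> i) x)
        = real ?n * \<psi> ?r + \<psi>' ?r / ?r * (\<Sum>i\<in>UNIV. x $ i * x $ i)"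
      by (simp add: pd sum.distrib sum_distrib_left algebra_simps)
    also have "\<dots> = \<eta>' ?r / ?r ^ (?n - 1)"
    proof (cases "x = 0")
      case True
      then show ?thesis using \<psi>_zero[of 0] \<eta>'0[of 0] \<delta>(1) by simp
    next
      case False
      have "?r ^ ?n = ?r * ?r ^ (?n - 1)"
        by (simp add: power_eq_if)
      then show ?thesis using False by (simp add: sq \<psi>_def \<psi>'_def field_simps)
    qed
    finally show ?thesis .
  qed
  have "(LINT x|lebesgue. u x * (\<eta>' (norm x) / norm x ^ (?n - 1)))
      = (\<Sum>i\<in>UNIV. LINT x|lebesgue. u x * partial_deriv i (\<phi> i) x)"
    unfolding div[symmetric] sum_distrib_left by (rule Bochner_Integration.integral_sum) (rule int_u)
  also have "\<dots> = (\<Sum>i\<in>UNIV. - (LINT x|lebesgue. v x $ i * \<phi> i x))"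
    using weak test by (intro sum.cong) (auto simp: has_weak_gradient_def)
  also have "\<dots> = - (LINT x|lebesgue. (\<Sum>i\<in>UNIV. v x $ i * \<phi> i x))"
    by (subst Bochner_Integration.integral_sum) (auto simp: int_v sum_negf)
  also have "(\<lambda>x. \<Sum>i\<in>UNIV. v x $ i * \<phi> i x) = (\<lambda>x. (v x \<bullet> x) * (\<eta> (norm x) / norm x ^ ?n))"
    by (intro ext) (simp add: inner_vec_def sum_distrib_right sum_divide_distrib \<phi>_def \<psi>_def mult.assoc)
  finally show ?thesis .
qed

lemma antiderivative_of_bump:
  fixes b :: "real \<Rightarrow> real"
  assumes cont: "continuous_on UNIV b" and nonneg: "\<And>r. b r \<ge> 0"
    and supp: "\<And>r. \<not> (p < r \<and> r < q) \<Longrightarrow> b r = 0" and pq: "p < q"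
  obtains A where "\<And>r. (A has_real_derivative b r) (at r)" "\<And>r. r \<le> p \<Longrightarrow> A r = 0"
    "\<And>r. r \<ge> q \<Longrightarrow> A r = (LINT s|lborel. b s)" "\<And>r. 0 \<le> A r" "\<And>r. A r \<le> (LINT s|lborel. b s)"
    "integrable lborel b"
proof -
  have "integrable lborel (\<lambda>r. indicator {p..q} r *\<^sub>R b r)"
    using cont by (intro borel_integrable_compact) (auto intro: continuous_on_subset)
  also have "(\<lambda>r. indicator {p..q} r *\<^sub>R b r) = b"
  proof
    fix r show "indicator {p..q} r *\<^sub>R b r = b r"
      using supp[of r] by (cases "p < r \<and> r < q") auto
  qed
  finally have int: "integrable lborel b" .
  define A where "A r = integral {p - 1..r} b" for r
  have left: "A r = 0" if "r \<le> p" for r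
    unfolding A_def using that supp by (intro integral_unique has_integral_is_0) auto
  have deriv: "(A has_real_derivative b r) (at r)" for r
  proof (cases "r < p")
    case True
    then show ?thesis
      using DERIV_vanishing_nearby[of p A r] left supp[of r] by auto
  next
    case False
    have "(A has_real_derivative b r) (at r within {p - 1..r + 1})"
      unfolding A_def using False
      by (intro integral_has_real_derivative continuous_on_subset[OF cont]) auto
    moreover have "at r within {p - 1..r + 1} = at r"
      using False by (intro at_within_interior) auto
    ultimately show ?thesis by simp
  qed
  have right: "A r = (LINT s|lborel. b s)" if "r \<ge> q" for r
  proof -
    have "(b has_integral (LINT s|lborel. b s)) UNIV" by (rule has_integral_integral_lborel[OF int])
    moreover have "b = (\<lambda>s. if s \<in> {p - 1..r} then b s else 0)"
    proof
      fix s show "b s = (if s \<in> {p - 1..r} then b s else 0)"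
        using supp[of s] that by (cases "p < s \<and> s < q") auto
    qed
    ultimately have "(b has_integral (LINT s|lborel. b s)) {p - 1..r}"
      using has_integral_restrict_UNIV[of "{p - 1..r}" b] by simp
    then show ?thesis unfolding A_def by (rule integral_unique)
  qed
  have mono: "A r \<le> A s" if "r \<le> s" for r s
    using deriv nonneg by (intro DERIV_nonneg_imp_nondecreasing[OF that]) blast
  show ?thesis
  proof (rule that[OF deriv left right _ _ int])
    show "0 \<le> A r" for r using mono[of "min r p" r] left[of "min r p"] by simp
    show "A r \<le> (LINT s|lborel. b s)" for r using mono[of r "max r q"] right[of "max r q"] by simp
  qed
qed

text \<open>A bound for a smooth function of integral \<open>1\<close> supported in an interval of length \<open>1/2\<close>, rounded
  up to be at least \<open>1\<close> so that it also dominates the coefficient of the gradient term below.\<close>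

definition cutoff_bound :: real where
  "cutoff_bound = max 1 (1 / (LINT s|lborel. bump 0 0 (1/2) s))"

lemma integral_bump_pos:
  assumes pq: "p < q"
  shows "(LINT s|lborel. bump m p q s) > 0"
proof -
  obtain A where A: "\<And>r. (A has_real_derivative bump m p q r) (at r)" "\<And>r. r \<le> p \<Longrightarrow> A r = 0"
    "\<And>r. r \<ge> q \<Longrightarrow> A r = (LINT s|lborel. bump m p q s)"
    by (rule antiderivative_of_bump[OF smooth_upto_imp_continuous[OF smooth_upto_bump]
          bump_nonneg bump_zero pq]) auto
  have "A p < A q"
  proof (rule DERIV_pos_imp_increasing_open[OF pq])
    show "\<exists>y. (A has_real_derivative y) (at r) \<and> 0 < y" if "p < r" "r < q" for r
      using A(1) bump_pos[OF that] by blast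
    show "continuous_on {p..q} A"
      using DERIV_isCont[OF A(1)] by (blast intro: continuous_at_imp_continuous_on)
  qed
  then show ?thesis using A(2,3) by simp
qed

lemma lebesgue_integral_radial:
  fixes u :: "real^'n \<Rightarrow> real"
  assumes [measurable]: "g \<in> borel_measurable borel" "\<rho> \<in> borel_measurable borel"
    and u: "AE x in lebesgue. u x = g (norm x)" "u \<in> borel_measurable lebesgue"
    and \<rho>: "\<And>r. r \<le> 0 \<Longrightarrow> \<rho> r = 0"
  shows "(LINT x|lebesgue. u x * (\<rho> (norm x) / norm x ^ (CARD('n) - 1)))
      = sphere_area TYPE(real^'n) * (LINT r|lborel. g r * \<rho> r)"
    and "integrable lebesgue (\<lambda>x. u x * (\<rho> (norm x) / norm x ^ (CARD('n) - 1)))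
      \<longleftrightarrow> integrable lborel (\<lambda>r. g r * \<rho> r)"
proof -
  let ?f = "\<lambda>x::real^'n. u x * (\<rho> (norm x) / norm x ^ (CARD('n) - 1))"
  let ?h = "\<lambda>x::real^'n. (g (norm x) * \<rho> (norm x)) / norm x ^ (CARD('n) - 1)"
  note [measurable] = u(2)
  have [measurable]: "?h \<in> borel_measurable lborel" by measurable
  have [measurable]: "(\<lambda>x::real^'n. \<rho> (norm x) / norm x ^ (CARD('n) - 1)) \<in> borel_measurable lebesgue"
    by (intro measurable_completion) measurable
  have f: "?f \<in> borel_measurable lebesgue" by measurable
  have h: "?h \<in> borel_measurable lebesgue" by (intro measurable_completion) measurable
  have ae: "AE x in lebesgue. ?f x = ?h x" using u(1) by eventually_elim simp
  have "integral\<^sup>L lebesgue ?f = integral\<^sup>L lebesgue ?h" by (rule integral_cong_AE[OF f h ae])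
  also have "\<dots> = integral\<^sup>L lborel ?h" by (rule integral_completion) measurable
  also have "\<dots> = sphere_area TYPE(real^'n) * (LINT r|lborel. g r * \<rho> r)"
    using integral_radial[where 'a="real^'n", of "\<lambda>r. g r * \<rho> r"] \<rho> by simp
  finally show "integral\<^sup>L lebesgue ?f = sphere_area TYPE(real^'n) * (LINT r|lborel. g r * \<rho> r)" .
  have "integrable lebesgue ?f \<longleftrightarrow> integrable lebesgue ?h"
    by (rule integrable_cong_AE[OF f h ae])
  also have "\<dots> \<longleftrightarrow> integrable lborel ?h" by (rule integrable_completion) measurable
  also have "\<dots> \<longleftrightarrow> integrable lborel (\<lambda>r. g r * \<rho> r)"
    using integrable_radial_iff[where 'a="real^'n", of "\<lambda>r. g r * \<rho> r"] \<rho> by simp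
  finally show "integrable lebesgue ?f \<longleftrightarrow> integrable lborel (\<lambda>r. g r * \<rho> r)" .
qed

text \<open>The weight under which integrals over a shell of thickness \<open>1\<close> become one-dimensional integrals
  over the radius, up to the area of the unit sphere.\<close>

definition shell_weight :: "real \<Rightarrow> real^'n::finite \<Rightarrow> real" where
  "shell_weight p x = indicator {p<..<p + 1} (norm x) / norm x ^ (CARD('n) - 1)"

text \<open>
  A smoothed form of \<open>|g(r)| \<le> K \<integral> (|g| + |g'|)\<close>, the integral being over \<open>(p, p + 1)\<close>. Let
  \<open>\<kappa>\<close> be a bump of integral \<open>1\<close> located to the right of the support of \<open>\<rho>\<close>, and let \<open>m = \<integral> \<rho>\<close>. The
  antiderivative \<open>\<eta>\<close> of \<open>\<rho> - m \<kappa>\<close> rises from \<open>0\<close> to \<open>m\<close> and returns to \<open>0\<close> before \<open>p + 1\<close>, so it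
  is an admissible profile for the test field. The mean of \<open>g\<close> against \<open>\<rho>\<close> is thereby compared with its
  mean against \<open>m \<kappa>\<close>, and the difference is an integral of the gradient against \<open>\<eta> \<le> m\<close>.
\<close>

lemma radial_mean_bound:
  fixes u :: "real^'n \<Rightarrow> real"
  assumes weak: "has_weak_gradient u v"
    and g [measurable]: "g \<in> borel_measurable borel" and ug: "AE x in lebesgue. u x = g (norm x)"
    and p: "0 < p" "p < q" "q \<le> p + 1/2"
    and B: "(\<integral>\<^sup>+x. ennreal (\<bar>u x\<bar> + norm (v x)) * ennreal (shell_weight p x) \<partial>lebesgue) \<le> ennreal B"
      "B \<ge> 0"
    and smooth: "\<And>k. smooth_upto k \<rho>" and nonneg: "\<And>r. \<rho> r \<ge> 0"
    and supp: "\<And>r. \<not> (p < r \<and> r < q) \<Longrightarrow> \<rho> r = 0"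
  shows "\<bar>sphere_area TYPE(real^'n) * (LINT r|lborel. g r * \<rho> r)\<bar>
    \<le> cutoff_bound * B * (LINT r|lborel. \<rho> r)"
proof -
  let ?n = "CARD('n)"
  define \<beta> where "\<beta> = (LINT s|lborel. bump 0 0 (1/2) s)"
  have \<beta>: "\<beta> > 0" unfolding \<beta>_def by (rule integral_bump_pos) simp
  define \<kappa> where "\<kappa> r = bump 0 q (q + 1/2) r / \<beta>" for r
  have \<kappa>_nonneg: "\<kappa> r \<ge> 0" for r using \<beta> by (simp add: \<kappa>_def bump_nonneg)
  have \<kappa>_le: "\<kappa> r \<le> cutoff_bound" for r
  proof -
    have "\<kappa> r \<le> 1 / \<beta>" using \<beta> bump_le_1 by (simp add: \<kappa>_def divide_right_mono)
    then show ?thesis by (simp add: cutoff_bound_def \<beta>_def)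
  qed
  have \<kappa>_supp: "\<kappa> r = 0" if "\<not> (q < r \<and> r < q + 1/2)" for r
    using that by (simp add: \<kappa>_def bump_zero)
  have \<kappa>_smooth: "smooth_upto k \<kappa>" for k
    using smooth_upto_mult[OF smooth_upto_const[of k "1/\<beta>"] smooth_upto_bump[of k 0 q "q+1/2"]]
    by (simp add: \<kappa>_def[abs_def])
  have \<kappa>_int: "(LINT r|lborel. \<kappa> r) = 1"
  proof -
    have "(LINT r|lborel. bump 0 q (q + 1/2) r) = (LINT r|lborel. bump 0 q (q + 1/2) (q + 1 * r))"
      by (subst lborel_integral_real_affine[of 1 _ q]) auto
    also have "\<dots> = \<beta>" unfolding \<beta>_def by (simp add: bump_def[abs_def])
    finally show ?thesis using \<beta> by (simp add: \<kappa>_def)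
  qed
  define m where "m = (LINT r|lborel. \<rho> r)"
  obtain A where "\<And>r. (A has_real_derivative \<rho> r) (at r)" "\<And>r. r \<le> p \<Longrightarrow> A r = 0"
    "\<And>r. r \<ge> q \<Longrightarrow> A r = (LINT r|lborel. \<rho> r)" "\<And>r. 0 \<le> A r"
    "\<And>r. A r \<le> (LINT r|lborel. \<rho> r)"
    by (rule antiderivative_of_bump[OF smooth_upto_imp_continuous[OF smooth] nonneg supp p(2)])
      (assumption, rule that)
  note A = this[folded m_def]
  have q: "q < q + 1/2" by simp
  obtain D where "\<And>r. (D has_real_derivative \<kappa> r) (at r)" "\<And>r. r \<le> q \<Longrightarrow> D r = 0"
    "\<And>r. r \<ge> q + 1/2 \<Longrightarrow> D r = (LINT r|lborel. \<kappa> r)" "\<And>r. 0 \<le> D r"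
    "\<And>r. D r \<le> (LINT r|lborel. \<kappa> r)"
    by (rule antiderivative_of_bump[OF smooth_upto_imp_continuous[OF \<kappa>_smooth] \<kappa>_nonneg \<kappa>_supp q])
      (assumption, rule that)
  note D = this[unfolded \<kappa>_int]
  have m: "m \<ge> 0" using A(4,5) order_trans by blast
  define \<theta> where "\<theta> r = \<rho> r - m * \<kappa> r" for r
  define \<eta> where "\<eta> r = A r - m * D r" for r
  have \<eta>_deriv: "(\<eta> has_real_derivative \<theta> r) (at r)" for r
    unfolding \<eta>_def \<theta>_def using A(1) D(1) by (auto intro!: derivative_eq_intros)
  have \<theta>_smooth: "smooth_upto k \<theta>" for k
    unfolding \<theta>_def
    by (intro smooth_upto_diff smooth_upto_mult smooth_upto_const smooth \<kappa>_smooth)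
  have \<eta>_smooth: "smooth_upto k \<eta>" for k
    using smooth_upto_SucI[OF \<eta>_deriv \<theta>_smooth] by (rule smooth_upto_Suc_imp)
  have \<eta>_outside: "\<eta> r = 0" if "r \<le> p \<or> q + 1/2 \<le> r" for r
    using that p A(2,3)[of r] D(2,3)[of r] by (auto simp: \<eta>_def)
  have \<eta>_left: "\<eta> r = 0" if "r < p" for r using that \<eta>_outside by simp
  have \<eta>_right: "\<eta> r = 0" if "r > q + 1/2" for r using that \<eta>_outside by simp
  have \<eta>_bounds: "0 \<le> \<eta> r" "\<eta> r \<le> m" for r
  proof -
    have "0 \<le> \<eta> r \<and> \<eta> r \<le> m"
    proof (cases "r \<le> q")
      case True
      then show ?thesis using A D by (simp add: \<eta>_def)
    next
      case False
      then have "\<eta> r = m * (1 - D r)" using A(3) by (simp add: \<eta>_def algebra_simps)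
      then show ?thesis using m D(4,5)[of r] by (simp add: mult_left_le)
    qed
    then show "0 \<le> \<eta> r" "\<eta> r \<le> m" by auto
  qed
  have loc: "locally_integrable u" "locally_integrable v"
    using weak by (auto simp: has_weak_gradient_def)
  have [measurable]: "u \<in> borel_measurable lebesgue" "v \<in> borel_measurable lebesgue"
    using loc by (auto simp: locally_integrable_def)
  have radial_int: "integrable lebesgue (\<lambda>x. u x * (f (norm x) / norm x ^ (?n - 1)))"
    if "\<And>k. smooth_upto k f" "\<And>r. r < p \<Longrightarrow> f r = 0" "\<And>r. r > q + 1/2 \<Longrightarrow> f r = 0" for f
  proof -
    have "continuous_on UNIV (\<lambda>x::real^'n. f (norm x) / norm x ^ (?n - 1))"
      using Ck_radial[OF smooth_upto_divide_power[OF that(1) p(1) that(2), of 0 "?n - 1"] p(1)] that(2)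
      by simp
    then have "integrable lebesgue (\<lambda>x. (f (norm x) / norm x ^ (?n - 1)) *\<^sub>R u x)"
      by (rule integrable_continuous_mult_locally_integrable[OF loc(1), where P = "q + 1/2"])
        (simp add: that(3))
    then show ?thesis by (simp add: mult.commute)
  qed
  have borel: "f \<in> borel_measurable borel" if "\<And>k. smooth_upto k f" for f
    using smooth_upto_imp_continuous[OF that[of 0]] by (rule borel_measurable_continuous_onI)
  have \<rho>_zero: "\<rho> r = 0" if "r \<le> 0" for r using that p supp by auto
  let ?U = "\<lambda>x. u x * (\<kappa> (norm x) / norm x ^ (?n - 1))"
  let ?V = "\<lambda>x. (v x \<bullet> x) * (\<eta> (norm x) / norm x ^ ?n)"
  have int_\<rho>: "integrable lebesgue (\<lambda>x. u x * (\<rho> (norm x) / norm x ^ (?n - 1)))"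
    using p supp by (intro radial_int smooth) auto
  have int_U: "integrable lebesgue ?U"
    using p \<kappa>_supp by (intro radial_int \<kappa>_smooth) auto
  have int_mU: "integrable lebesgue (\<lambda>x. m * ?U x)"
    by (rule integrable_mult_right) (rule int_U)
  have int_V: "integrable lebesgue ?V"
  proof -
    have "integrable lebesgue (\<lambda>x. (\<eta> (norm x) / norm x ^ ?n * x $ i) *\<^sub>R v x)" for i
    proof (rule integrable_continuous_mult_locally_integrable[OF loc(2), where P="q+1/2"])
      have "Ck 0 (\<lambda>x::real^'n. \<eta> (norm x) / norm x ^ ?n * x $ i)"
        using \<eta>_left
        by (intro Ck_mult Ck_coordinate
            Ck_radial[OF smooth_upto_divide_power[OF \<eta>_smooth p(1) \<eta>_left] p(1)]) auto
      then show "continuous_on UNIV (\<lambda>x::real^'n. \<eta> (norm x) / norm x ^ ?n * x $ i)" by simp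
    qed (simp add: \<eta>_right)
    from integrable_bounded_linear[OF bounded_linear_vec_nth this]
    have "integrable lebesgue (\<lambda>x. \<Sum>i\<in>UNIV. ((\<eta> (norm x) / norm x ^ ?n * x $ i) *\<^sub>R v x) $ i)"
      by (intro Bochner_Integration.integrable_sum)
    also have "(\<lambda>x. \<Sum>i\<in>UNIV. ((\<eta> (norm x) / norm x ^ ?n * x $ i) *\<^sub>R v x) $ i) = ?V"
      by (intro ext) (simp add: inner_vec_def sum_distrib_left sum_divide_distrib mult_ac)
    finally show ?thesis .
  qed
  have "(LINT x|lebesgue. u x * (\<theta> (norm x) / norm x ^ (?n - 1))) = - integral\<^sup>L lebesgue ?V"
    by (rule weak_gradient_radial_test[OF weak \<eta>_deriv \<eta>_smooth p(1) \<eta>_left \<eta>_right])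
  also have "(\<lambda>x. u x * (\<theta> (norm x) / norm x ^ (?n - 1)))
      = (\<lambda>x. u x * (\<rho> (norm x) / norm x ^ (?n - 1)) - m * ?U x)"
    by (intro ext) (simp add: \<theta>_def diff_divide_distrib right_diff_distrib mult_ac)
  also have "(LINT x|lebesgue. u x * (\<rho> (norm x) / norm x ^ (?n - 1)) - m * ?U x)
      = (LINT x|lebesgue. u x * (\<rho> (norm x) / norm x ^ (?n - 1))) - (LINT x|lebesgue. m * ?U x)"
    by (rule Bochner_Integration.integral_diff[OF int_\<rho> int_mU])
  also have "(LINT x|lebesgue. u x * (\<rho> (norm x) / norm x ^ (?n - 1)))
      = sphere_area TYPE(real^'n) * (LINT r|lborel. g r * \<rho> r)"
    by (rule lebesgue_integral_radial) (use ug \<rho>_zero borel smooth in auto)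
  finally have eq: "sphere_area TYPE(real^'n) * (LINT r|lborel. g r * \<rho> r)
      = (LINT x|lebesgue. m * ?U x) - integral\<^sup>L lebesgue ?V" by simp
  also have "\<dots> = (LINT x|lebesgue. m * ?U x - ?V x)"
    by (rule Bochner_Integration.integral_diff[OF int_mU int_V, symmetric])
  finally have eq: "sphere_area TYPE(real^'n) * (LINT r|lborel. g r * \<rho> r)
      = (LINT x|lebesgue. m * ?U x - ?V x)" .
  have cb: "cutoff_bound \<ge> 1" by (simp add: cutoff_bound_def)
  have pointwise: "\<bar>m * ?U x - ?V x\<bar> \<le> (m * cutoff_bound) * ((\<bar>u x\<bar> + norm (v x)) * shell_weight p x)"
    for x
  proof (cases "p < norm x \<and> norm x < p + 1")
    case True
    let ?w = "1 / norm x ^ (?n - 1)"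
    have w: "?w \<ge> 0" by simp
    have nx: "norm x > 0" using True p by linarith
    have npow: "norm x ^ ?n = norm x * norm x ^ (?n - 1)" by (simp add: power_eq_if)
    have "\<bar>m * ?U x\<bar> = m * \<kappa> (norm x) * \<bar>u x\<bar> * ?w"
      using m \<kappa>_nonneg by (simp add: abs_mult)
    also have "\<dots> \<le> m * cutoff_bound * \<bar>u x\<bar> * ?w"
      using m \<kappa>_le by (intro mult_right_mono mult_left_mono) auto
    finally have 1: "\<bar>m * ?U x\<bar> \<le> m * cutoff_bound * \<bar>u x\<bar> * ?w" .
    have "\<bar>?V x\<bar> = \<bar>v x \<bullet> x\<bar> * (\<eta> (norm x) / norm x ^ ?n)"
      using \<eta>_bounds by (simp add: abs_mult)
    also have "\<dots> \<le> (norm (v x) * norm x) * (m / norm x ^ ?n)"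
      using \<eta>_bounds m Cauchy_Schwarz_ineq2 by (intro mult_mono divide_right_mono) auto
    also have "\<dots> = m * norm (v x) * ?w" using nx unfolding npow by simp
    also have "\<dots> \<le> m * cutoff_bound * norm (v x) * ?w"
      using m cb by (intro mult_right_mono) (auto simp: mult_le_cancel_left1)
    finally have 2: "\<bar>?V x\<bar> \<le> m * cutoff_bound * norm (v x) * ?w" .
    have "\<bar>m * ?U x - ?V x\<bar> \<le> m * cutoff_bound * \<bar>u x\<bar> * ?w + m * cutoff_bound * norm (v x) * ?w"
      using 1 2 abs_triangle_ineq4[of "m * ?U x" "?V x"] by linarith
    also have "\<dots> = (m * cutoff_bound) * ((\<bar>u x\<bar> + norm (v x)) * shell_weight p x)"
      using True by (simp add: shell_weight_def algebra_simps add_divide_distrib)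
    finally show ?thesis .
  next
    case False
    then have "\<kappa> (norm x) = 0" "\<eta> (norm x) = 0"
      using p \<kappa>_supp[of "norm x"] \<eta>_outside[of "norm x"] by auto
    then show ?thesis using False by (simp add: shell_weight_def)
  qed
  have sw: "shell_weight p x \<ge> 0" for x :: "real^'n"
    by (simp add: shell_weight_def)
  have sw_meas [measurable]: "shell_weight p \<in> borel_measurable (lebesgue :: (real^'n) measure)"
    unfolding shell_weight_def[abs_def] by (intro measurable_completion) measurable
  have "ennreal \<bar>LINT x|lebesgue. m * ?U x - ?V x\<bar> \<le> (\<integral>\<^sup>+x. ennreal \<bar>m * ?U x - ?V x\<bar> \<partial>lebesgue)"
    using integral_norm_bound_ennreal[OF Bochner_Integration.integrable_diff[OF int_mU int_V]]
    by (simp only: real_norm_def)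
  also have "\<dots> \<le> (\<integral>\<^sup>+x. ennreal (m * cutoff_bound)
      * (ennreal (\<bar>u x\<bar> + norm (v x)) * ennreal (shell_weight p x)) \<partial>lebesgue)"
  proof (rule nn_integral_mono)
    fix x
    have "ennreal (m * cutoff_bound) * (ennreal (\<bar>u x\<bar> + norm (v x)) * ennreal (shell_weight p x))
        = ennreal ((m * cutoff_bound) * ((\<bar>u x\<bar> + norm (v x)) * shell_weight p x))"
      using m cb sw[of x] by (simp add: ennreal_mult)
    then show "ennreal \<bar>m * ?U x - ?V x\<bar> \<le> ennreal (m * cutoff_bound)
        * (ennreal (\<bar>u x\<bar> + norm (v x)) * ennreal (shell_weight p x))"
      using pointwise[of x] by (simp add: ennreal_leI)
  qed
  also have "\<dots> = ennreal (m * cutoff_bound)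
      * (\<integral>\<^sup>+x. ennreal (\<bar>u x\<bar> + norm (v x)) * ennreal (shell_weight p x) \<partial>lebesgue)"
    by (rule nn_integral_cmult) measurable
  also have "\<dots> \<le> ennreal (m * cutoff_bound) * ennreal B" by (intro mult_left_mono B) simp
  also have "\<dots> = ennreal (cutoff_bound * B * m)" using m cb B by (simp add: ennreal_mult mult_ac)
  finally show ?thesis
    unfolding eq m_def[symmetric] using m cb B by (subst (asm) ennreal_le_iff) auto
qed

section \<open>The pointwise decay estimate\<close>

text \<open>
  The inequality says that the measure with density \<open>g\<^sup>+\<close> is dominated on intervals by the one with
  density \<open>b + g\<^sup>-\<close>, hence on all Borel sets; the set \<open>{g > b}\<close> then has to be null. Splitting \<open>g\<close> into
  its two parts keeps both measures positive and finite.
\<close>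

lemma AE_le_if_interval_integrals_le:
  fixes g :: "real \<Rightarrow> real"
  assumes [measurable]: "g \<in> borel_measurable borel"
    and int: "integrable lborel (\<lambda>r. g r * indicator {P<..<Q} r)" and b: "b \<ge> 0"
    and le: "\<And>p q. P \<le> p \<Longrightarrow> p < q \<Longrightarrow> q \<le> Q
      \<Longrightarrow> (LINT r|lborel. g r * indicator {p<..<q} r) \<le> b * (q - p)"
  shows "AE r in lborel. r \<in> {P<..<Q} \<longrightarrow> g r \<le> b"
proof (cases "P < Q")
  case PQ: True
  let ?I = "indicator {P<..<Q} :: real \<Rightarrow> real"
  define M where "M = density lborel (\<lambda>r. ennreal (max 0 (g r) * ?I r))"
  define N where "N = density lborel (\<lambda>r. ennreal ((b + max 0 (- g r)) * ?I r))"
  have int_sub: "integrable lborel (\<lambda>r. f r * indicator A r)"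
    if "A \<in> sets borel" "A \<subseteq> {P<..<Q}" "f \<in> borel_measurable borel" "\<And>r. \<bar>f r\<bar> \<le> \<bar>g r\<bar>" for f A
  proof (rule Bochner_Integration.integrable_bound[OF int])
    show "(\<lambda>r. f r * indicator A r) \<in> borel_measurable lborel" using that by measurable
    show "AE r in lborel. norm (f r * indicator A r) \<le> norm (g r * ?I r)"
      using that by (intro AE_I2) (auto simp: indicator_def)
  qed
  have int_const: "integrable lborel (\<lambda>r. b * indicator {p<..<q} r)" for p q :: real
    by (cases "p \<le> q") (auto intro!: integrable_mult_right integrable_real_indicator)
  have M_eq: "emeasure M E = (\<integral>\<^sup>+r. ennreal (max 0 (g r) * indicator (E \<inter> {P<..<Q}) r) \<partial>lborel)"
    if "E \<in> sets borel" for E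
    using that unfolding M_def
    by (subst emeasure_density) (auto intro!: nn_integral_cong simp: indicator_def)
  have N_eq: "emeasure N E = (\<integral>\<^sup>+r. ennreal ((b + max 0 (- g r)) * indicator (E \<inter> {P<..<Q}) r) \<partial>lborel)"
    if "E \<in> sets borel" for E
    using that unfolding N_def
    by (subst emeasure_density) (auto intro!: nn_integral_cong simp: indicator_def)
  have M_int: "emeasure M {p<..<q} = ennreal (LINT r|lborel. max 0 (g r) * indicator {p<..<q} r)"
    and N_int: "emeasure N {p<..<q} = ennreal (LINT r|lborel. (b + max 0 (- g r)) * indicator {p<..<q} r)"
    and int_M: "integrable lborel (\<lambda>r. max 0 (g r) * indicator {p<..<q} r)"
    and int_N: "integrable lborel (\<lambda>r. max 0 (- g r) * indicator {p<..<q} r)"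
    and int_bN: "integrable lborel (\<lambda>r. (b + max 0 (- g r)) * indicator {p<..<q} r)"
    if pq: "P \<le> p" "q \<le> Q" for p q
  proof -
    have sub: "{p<..<q} \<subseteq> {P<..<Q}" using pq by auto
    then have cap: "{p<..<q} \<inter> {P<..<Q} = {p<..<q}" by auto
    show int_M: "integrable lborel (\<lambda>r. max 0 (g r) * indicator {p<..<q} r)"
      using sub by (intro int_sub) auto
    show int_N: "integrable lborel (\<lambda>r. max 0 (- g r) * indicator {p<..<q} r)"
      using sub by (intro int_sub) auto
    show int_bN: "integrable lborel (\<lambda>r. (b + max 0 (- g r)) * indicator {p<..<q} r)"
      using Bochner_Integration.integrable_add[OF int_const int_N, of p q] by (simp add: distrib_right)
    show "emeasure M {p<..<q} = ennreal (LINT r|lborel. max 0 (g r) * indicator {p<..<q} r)"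
      by (subst M_eq) (auto simp only: cap intro!: nn_integral_eq_integral int_M, auto)
    show "emeasure N {p<..<q} = ennreal (LINT r|lborel. (b + max 0 (- g r)) * indicator {p<..<q} r)"
      using b by (subst N_eq) (auto simp only: cap intro!: nn_integral_eq_integral int_bN, auto)
  qed
  have MN: "emeasure M E \<le> emeasure N E" if E: "E \<in> sets borel" for E
  proof (rule emeasure_le_if_le_on_intervals[OF _ _ _ _ _ E])
    show "sets M = sets borel" "sets N = sets borel" by (simp_all add: M_def N_def)
    have "emeasure M UNIV = emeasure M {P<..<Q}" by (subst (1 2) M_eq) auto
    then show "emeasure M (space M) \<noteq> \<infinity>" using M_int[of P Q] by (simp add: M_def)
    have "emeasure N UNIV = emeasure N {P<..<Q}" by (subst (1 2) N_eq) auto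
    then show "emeasure N (space N) \<noteq> \<infinity>" using N_int[of P Q] by (simp add: N_def)
    fix p q :: real assume "p < q"
    define p' q' where "p' = max p P" and "q' = min q Q"
    have pq': "P \<le> p'" "q' \<le> Q" by (auto simp: p'_def q'_def)
    have cap: "{p<..<q} \<inter> {P<..<Q} = {p'<..<q'} \<inter> {P<..<Q}" by (auto simp: p'_def q'_def)
    have "emeasure M {p'<..<q'} \<le> emeasure N {p'<..<q'}"
    proof (cases "p' < q'")
      case True
      have "(LINT r|lborel. max 0 (g r) * indicator {p'<..<q'} r)
          = (LINT r|lborel. g r * indicator {p'<..<q'} r + max 0 (- g r) * indicator {p'<..<q'} r)"
        by (intro Bochner_Integration.integral_cong) (auto simp: indicator_def)
      also have "\<dots> = (LINT r|lborel. g r * indicator {p'<..<q'} r)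
          + (LINT r|lborel. max 0 (- g r) * indicator {p'<..<q'} r)"
        using pq' by (intro Bochner_Integration.integral_add int_N int_sub) auto
      also have "\<dots> \<le> b * (q' - p') + (LINT r|lborel. max 0 (- g r) * indicator {p'<..<q'} r)"
        using le[OF pq'(1) True pq'(2)] by simp
      also have "\<dots> = (LINT r|lborel. b * indicator {p'<..<q'} r)
          + (LINT r|lborel. max 0 (- g r) * indicator {p'<..<q'} r)"
        using True by simp
      also have "\<dots> = (LINT r|lborel. (b + max 0 (- g r)) * indicator {p'<..<q'} r)"
        using int_const int_N[OF pq']
        by (subst Bochner_Integration.integral_add[symmetric]) (auto simp: distrib_right)
      finally show ?thesis unfolding M_int[OF pq'] N_int[OF pq'] by (rule ennreal_leI)
    qed simp
    then show "emeasure M {p<..<q} \<le> emeasure N {p<..<q}"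
      using cap M_eq N_eq by simp
  qed
  define E where "E = {r. g r > b} \<inter> {P<..<Q}"
  have E [measurable]: "E \<in> sets borel" unfolding E_def by measurable
  have fin: "(\<integral>\<^sup>+r. ennreal (b * indicator E r) \<partial>lborel) \<noteq> \<infinity>"
  proof -
    have "(\<integral>\<^sup>+r. ennreal (b * indicator E r) \<partial>lborel) \<le> (\<integral>\<^sup>+r. ennreal (b * indicator {P<..<Q} r) \<partial>lborel)"
      using b by (intro nn_integral_mono) (auto simp: indicator_def E_def)
    also have "\<dots> = ennreal (LINT r|lborel. b * indicator {P<..<Q} r)"
      using b by (intro nn_integral_eq_integral int_const) auto
    also have "\<dots> < \<infinity>" by simp
    finally show ?thesis by simp
  qed
  have "(\<integral>\<^sup>+r. ennreal (b * indicator E r) \<partial>lborel) + (\<integral>\<^sup>+r. ennreal ((g r - b) * indicator E r) \<partial>lborel)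
      = (\<integral>\<^sup>+r. ennreal (b * indicator E r) + ennreal ((g r - b) * indicator E r) \<partial>lborel)"
    by (rule nn_integral_add[symmetric]) measurable
  also have "\<dots> = (\<integral>\<^sup>+r. ennreal (max 0 (g r) * indicator (E \<inter> {P<..<Q}) r) \<partial>lborel)"
    using b by (intro nn_integral_cong)
      (auto simp: indicator_def E_def max_def simp flip: ennreal_plus)
  also have "\<dots> \<le> (\<integral>\<^sup>+r. ennreal ((b + max 0 (- g r)) * indicator (E \<inter> {P<..<Q}) r) \<partial>lborel)"
    using MN[OF E] M_eq[OF E] N_eq[OF E] by simp
  also have "\<dots> = (\<integral>\<^sup>+r. ennreal (b * indicator E r) \<partial>lborel)"
    using b by (intro nn_integral_cong) (auto simp: indicator_def E_def max_def)
  finally have "(\<integral>\<^sup>+r. ennreal ((g r - b) * indicator E r) \<partial>lborel) = 0"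
    using fin by (metis add.right_neutral ennreal_add_left_cancel_le infinity_ennreal_def le_zero_eq)
  then have "AE r in lborel. ennreal ((g r - b) * indicator E r) = 0"
    by (subst (asm) nn_integral_0_iff_AE) auto
  then show ?thesis
  proof eventually_elim
    case (elim r)
    then show ?case by (cases "b < g r") (auto simp: E_def ennreal_eq_0_iff)
  qed
qed simp

text \<open>
  Letting the bumps in \<open>radial_mean_bound\<close> tend to indicators bounds the mean of \<open>g\<close> over every
  short interval to the right of \<open>R\<close>, hence \<open>g\<close> itself almost everywhere.
\<close>

lemma radial_sup_bound:
  fixes u :: "real^'n \<Rightarrow> real"
  assumes weak: "has_weak_gradient u v"
    and ug: "AE x in lebesgue. u x = g0 (norm x)" and R: "R > 0"
    and B: "\<And>p. p \<ge> R \<Longrightarrow> (\<integral>\<^sup>+x. ennreal (\<bar>u x\<bar> + norm (v x)) * ennreal (shell_weight p x) \<partial>lebesgue)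
      \<le> ennreal B" "B \<ge> 0"
  shows "AE x in lebesgue. norm x > R
    \<longrightarrow> \<bar>u x\<bar> \<le> cutoff_bound / sphere_area TYPE(real^'n) * B"
proof -
  let ?c = "sphere_area TYPE(real^'n)"
  let ?b = "cutoff_bound / ?c * B"
  have c: "?c > 0" by (rule sphere_area_pos)
  have cb: "cutoff_bound > 0" by (simp add: cutoff_bound_def)
  have loc: "locally_integrable u" using weak by (simp add: has_weak_gradient_def)
  then have u_meas [measurable]: "u \<in> borel_measurable lebesgue" by (simp add: locally_integrable_def)
  obtain g where g [measurable]: "g \<in> borel_measurable borel"
    and ug: "AE x in lebesgue. u x = g (norm x)"
    using radial_borel_profile[OF u_meas ug] by blast
  have int_g: "integrable lborel (\<lambda>r. g r * indicator {p<..<q} r)" if "p > 0" for p q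
  proof -
    have "integrable lebesgue (\<lambda>x. (indicator {p<..<q} (norm x) / norm x ^ (CARD('n) - 1)) *\<^sub>R u x)"
    proof (rule integrable_mult_locally_integrable[OF loc, where C = "1 / p ^ (CARD('n) - 1)" and P = q])
      show "(\<lambda>x::real^'n. indicator {p<..<q} (norm x) / norm x ^ (CARD('n) - 1)) \<in> borel_measurable lebesgue"
        by (intro measurable_completion) measurable
      show "\<bar>indicator {p<..<q} (norm x) / norm x ^ (CARD('n) - 1)\<bar> \<le> 1 / p ^ (CARD('n) - 1)" for x :: "real^'n"
      proof (cases "p < norm x")
        case True
        then have "norm x > 0" "p ^ (CARD('n) - 1) \<le> norm x ^ (CARD('n) - 1)"
          using that by (auto intro: power_mono)
        then show ?thesis using that by (auto simp: indicator_def divide_simps)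
      qed (use that in simp)
    qed simp
    then show ?thesis
      using lebesgue_integral_radial(2)[OF g _ ug u_meas, of "indicator {p<..<q}"] that
      by (simp add: mult.commute)
  qed
  have interval: "\<bar>LINT r|lborel. g r * indicator {p<..<q} r\<bar> \<le> ?b * (q - p)"
    if pq: "R \<le> p" "p < q" "q \<le> p + 1/2" for p q
  proof -
    have p: "p > 0" using R pq by simp
    have "(\<lambda>m. LINT r|lborel. g r * bump m p q r) \<longlonglongrightarrow> (LINT r|lborel. g r * indicator {p<..<q} r)"
    proof (rule integral_dominated_convergence)
      show "integrable lborel (\<lambda>r. \<bar>g r * indicator {p<..<q} r\<bar>)"
        using int_g[OF p] by (rule integrable_abs)
      show "AE r in lborel. (\<lambda>m. g r * bump m p q r) \<longlonglongrightarrow> g r * indicator {p<..<q} r"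
        by (intro AE_I2 tendsto_mult tendsto_const bump_tendsto_indicator)
      show "AE r in lborel. norm (g r * bump m p q r) \<le> \<bar>g r * indicator {p<..<q} r\<bar>" for m
      proof (rule AE_I2)
        fix r show "norm (g r * bump m p q r) \<le> \<bar>g r * indicator {p<..<q} r\<bar>"
          using bump_le_1[of m p q r] bump_nonneg[of m p q r] bump_zero[of p r q m]
          by (cases "p < r \<and> r < q") (auto simp: abs_mult mult_left_le)
      qed
    qed measurable
    then have lim: "(\<lambda>m. \<bar>LINT r|lborel. g r * bump m p q r\<bar>)
        \<longlonglongrightarrow> \<bar>LINT r|lborel. g r * indicator {p<..<q} r\<bar>"
      by (rule tendsto_rabs)
    have "\<bar>LINT r|lborel. g r * bump m p q r\<bar> \<le> ?b * (q - p)" for m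
    proof -
      have mean: "\<bar>?c * (LINT r|lborel. g r * bump m p q r)\<bar> \<le> cutoff_bound * B * (LINT r|lborel. bump m p q r)"
        using R pq by (intro radial_mean_bound[OF weak g ug p pq(2,3) B(1,2)] smooth_upto_bump
            bump_nonneg bump_zero) auto
      have "(LINT r|lborel. bump m p q r) \<le> (LINT r|lborel. indicator {p<..<q} r)"
      proof (rule integral_mono_AE)
        show "integrable lborel (bump m p q)"
          by (rule antiderivative_of_bump[OF smooth_upto_imp_continuous[OF smooth_upto_bump]
                bump_nonneg bump_zero pq(2)])
        show "AE r in lborel. bump m p q r \<le> indicator {p<..<q} r"
          using bump_le_1[of m p q] bump_zero[of p _ q m]
          by (intro AE_I2) (auto simp: indicator_def)
      qed (use pq in \<open>auto intro!: integrable_real_indicator\<close>)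
      then have "(LINT r|lborel. bump m p q r) \<le> q - p" using pq by simp
      then have "cutoff_bound * B * (LINT r|lborel. bump m p q r) \<le> cutoff_bound * B * (q - p)"
        using cb B(2) by (intro mult_left_mono) auto
      with mean have "?c * \<bar>LINT r|lborel. g r * bump m p q r\<bar> \<le> cutoff_bound * B * (q - p)"
        using c by (simp add: abs_mult)
      then show ?thesis using c by (simp add: pos_le_divide_eq mult.commute)
    qed
    then show ?thesis by (intro LIMSEQ_le_const2[OF lim]) auto
  qed
  have b: "?b \<ge> 0" using c cb B(2) by simp
  have piece: "AE r in lborel. r \<in> {P<..<P + 1/2} \<longrightarrow> \<bar>g r\<bar> \<le> ?b" if P: "R \<le> P" for P
  proof -
    have P0: "P > 0" using R P by simp
    have "AE r in lborel. r \<in> {P<..<P + 1/2} \<longrightarrow> g r \<le> ?b"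
    proof (rule AE_le_if_interval_integrals_le[OF g int_g[OF P0] b])
      fix p q assume "P \<le> p" "p < q" "q \<le> P + 1/2"
      then show "(LINT r|lborel. g r * indicator {p<..<q} r) \<le> ?b * (q - p)"
        using interval[of p q] P by auto
    qed
    moreover have "AE r in lborel. r \<in> {P<..<P + 1/2} \<longrightarrow> - g r \<le> ?b"
    proof (rule AE_le_if_interval_integrals_le[OF _ _ b])
      show "integrable lborel (\<lambda>r. - g r * indicator {P<..<P + 1/2} r)"
        using int_g[OF P0, of "P + 1/2"] by simp
      fix p q assume "P \<le> p" "p < q" "q \<le> P + 1/2"
      then show "(LINT r|lborel. - g r * indicator {p<..<q} r) \<le> ?b * (q - p)"
        using interval[of p q] P by auto
    qed measurable
    ultimately show ?thesis by eventually_elim auto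
  qed
  (* Intervals of length 1/2 starting at multiples of 1/4 overlap, so that their union is all of
     (R, \<infinity>). *)
  have "AE r in lborel. \<forall>k::nat. r \<in> {R + real k / 4<..<R + real k / 4 + 1/2} \<longrightarrow> \<bar>g r\<bar> \<le> ?b"
    using piece by (intro AE_all_countable[THEN iffD2] allI) auto
  then have "AE r in lborel. r > R \<longrightarrow> \<bar>g r\<bar> \<le> ?b"
  proof eventually_elim
    case (elim r)
    show ?case
    proof
      assume r: "r > R"
      define k where "k = nat (\<lceil>4 * (r - R)\<rceil> - 1)"
      have "\<lceil>4 * (r - R)\<rceil> \<ge> 1" using r by simp
      then have "real k = of_int \<lceil>4 * (r - R)\<rceil> - 1" by (simp add: k_def)
      then have "real k < 4 * (r - R)" "4 * (r - R) \<le> real k + 1" by linarith+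
      then have "r \<in> {R + real k / 4<..<R + real k / 4 + 1/2}" by auto
      then show "\<bar>g r\<bar> \<le> ?b" using elim by blast
    qed
  qed
  then have "AE x in lborel. norm (x::real^'n) > R \<longrightarrow> \<bar>g (norm x)\<bar> \<le> ?b"
    by (rule AE_norm) measurable
  then have "AE x in lebesgue. norm (x::real^'n) > R \<longrightarrow> \<bar>g (norm x)\<bar> \<le> ?b"
    by (simp add: AE_completion_iff)
  with ug show ?thesis by eventually_elim simp
qed

lemma nn_integral_shell_weight:
  assumes "p > 0"
  shows "(\<integral>\<^sup>+x. ennreal (shell_weight p (x::real^'n)) \<partial>lebesgue) = ennreal (sphere_area TYPE(real^'n))"
proof -
  have "(\<integral>\<^sup>+x. ennreal (shell_weight p (x::real^'n)) \<partial>lebesgue)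
      = (\<integral>\<^sup>+x. indicator {p<..<p + 1} (norm x) * ennreal (1 / norm (x::real^'n) ^ (DIM(real^'n) - 1)) \<partial>lborel)"
    unfolding nn_integral_completion
    by (intro nn_integral_cong) (auto simp: shell_weight_def indicator_def)
  also have "\<dots> = ennreal (sphere_area TYPE(real^'n)) * (\<integral>\<^sup>+r. indicator {p<..<p + 1} r \<partial>lborel)"
    using assms by (intro nn_integral_radial) auto
  finally show ?thesis by simp
qed

lemma shell_weight_measurable: "shell_weight p \<in> borel_measurable lebesgue"
  unfolding shell_weight_def[abs_def] by (intro measurable_completion) measurable

lemma shell_weight_le:
  assumes "R > 0" "R \<le> p"
  shows "shell_weight p (x::real^'n) \<le> 1 / R ^ (CARD('n) - 1)"
proof (cases "p < norm x")
  case True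
  then have "norm x > 0" "R ^ (CARD('n) - 1) \<le> norm x ^ (CARD('n) - 1)"
    using assms by (auto intro!: power_mono)
  then show ?thesis using assms by (auto simp: shell_weight_def indicator_def divide_simps)
qed (use assms in \<open>simp add: shell_weight_def\<close>)

lemma sigma_finite_lebesgue: "sigma_finite_measure (lebesgue :: 'a::euclidean_space measure)"
proof
  have "(\<Union>k. cball (0::'a) (real k)) = space lebesgue"
    using real_arch_simple by (auto simp: cball_def)
  then show "\<exists>A::'a set set. countable A \<and> A \<subseteq> sets lebesgue \<and> \<Union> A = space lebesgue
      \<and> (\<forall>a\<in>A. emeasure lebesgue a \<noteq> \<infinity>)"
    using fmeasurableD2[OF lmeasurable_cball]
    by (intro exI[of _ "range (\<lambda>k. cball 0 (real k))"]) auto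
qed

section \<open>From the decay estimate to the exterior norm\<close>

lemma rearrangement_scale_le:
  assumes [measurable]: "f \<in> borel_measurable M" and k: "k > 0"
  shows "rearrangement M (\<lambda>x. ennreal k * f x) t \<le> ennreal k * rearrangement M f t"
proof (cases "rearrangement M f t")
  case (real l)
  have "{x \<in> space M. ennreal k * f x > ennreal (k * l)} = {x \<in> space M. f x > ennreal l}"
    using k real by (simp add: ennreal_mult ennreal_mult_le_mult_iff flip: not_le)
  moreover have "emeasure M {x \<in> space M. f x > ennreal l} \<le> ennreal t"
    using real by (subst rearrangement_le_iff[symmetric]) auto
  ultimately have "rearrangement M (\<lambda>x. ennreal k * f x) t \<le> ennreal (k * l)"
    using k real by (subst rearrangement_le_iff) auto
  then show ?thesis using k real by (simp add: ennreal_mult)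
next
  case top
  then show ?thesis using k by (simp add: ennreal_mult_top)
qed

text \<open>
  Below the height \<open>b\<close> every level set of the function on the right gains the whole plateau \<open>(0,a]\<close>, so
  its measure exceeds that of the level set of \<open>w\<close> by \<open>a\<close>; above \<open>b\<close> the level sets of \<open>w\<close> are null.
\<close>

lemma rearrangement_shift_le_plateau:
  assumes [measurable]: "w \<in> borel_measurable M" and bound: "AE x in M. w x \<le> ennreal b"
    and a: "a > 0" and t: "t > a"
  shows "rearrangement M w (t - a) \<le> rearrangement half_line
    (\<lambda>s. ennreal b * indicator {0<..a} s + rearrangement M w (s - a) * indicator {a<..} s) t"
    (is "_ \<le> rearrangement _ ?h t")
proof (cases "rearrangement half_line ?h t")
  case (real l)
  note [measurable] = rearrangement_measurable
  have h_borel [measurable]: "?h \<in> borel_measurable borel" by measurable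
  have "emeasure half_line {s \<in> space half_line. ?h s > ennreal l} \<le> ennreal t"
    using real borel_measurable_half_line[OF h_borel] by (subst rearrangement_le_iff[symmetric]) auto
  moreover have "ennreal a + emeasure M {x \<in> space M. w x > ennreal l}
      \<le> emeasure half_line {s \<in> space half_line. ?h s > ennreal l}" if "ennreal l < ennreal b"
  proof -
    let ?A = "{s. a < s \<and> ennreal l < rearrangement M w (s - a)}"
    have A: "?A \<in> sets borel" by measurable
    have "emeasure half_line ?A = emeasure M {x \<in> space M. w x > ennreal l}"
    proof -
      have "?A = {s \<in> space half_line. rearrangement M w (s - a) * indicator {a<..} s > ennreal l}"
        using a by (auto simp: space_half_line indicator_def split: if_splits)
      then show ?thesis using emeasure_rearrangement_shift[of w M l a] real a by simp
    qed
    moreover have "emeasure half_line {0<..a} = ennreal a"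
      using a by (subst emeasure_half_line) auto
    moreover have "emeasure half_line ({0<..a} \<union> ?A) = emeasure half_line {0<..a} + emeasure half_line ?A"
    proof (rule plus_emeasure[symmetric])
      show "{0<..a} \<in> sets half_line" "?A \<in> sets half_line"
        using a A by (auto simp: sets_restrict_space_iff)
    qed auto
    moreover have "emeasure half_line ({0<..a} \<union> ?A)
        \<le> emeasure half_line {s \<in> space half_line. ?h s > ennreal l}"
    proof (rule emeasure_mono)
      show "{0<..a} \<union> ?A \<subseteq> {s \<in> space half_line. ?h s > ennreal l}"
        using that a by (auto simp: space_half_line indicator_def)
      show "{s \<in> space half_line. ?h s > ennreal l} \<in> sets half_line"
        using borel_measurable_half_line[OF h_borel] by measurable
    qed
    ultimately show ?thesis by simp
  qed
  ultimately have sum: "ennreal a + emeasure M {x \<in> space M. w x > ennreal l} \<le> ennreal t"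
    if "ennreal l < ennreal b" using that order_trans by blast
  have "emeasure M {x \<in> space M. w x > ennreal l} \<le> ennreal (t - a)"
  proof (cases "ennreal l < ennreal b")
    case True
    with sum a t show ?thesis
      by (cases "emeasure M {x \<in> space M. w x > ennreal l}")
        (auto simp: top_unique simp flip: ennreal_plus)
  next
    case False
    have "AE x in M. \<not> w x > ennreal l"
      using bound by eventually_elim (use False in auto)
    then have "emeasure M {x \<in> space M. w x > ennreal l} = 0"
      by (subst (asm) AE_iff_measurable[OF _ refl]) auto
    then show ?thesis by simp
  qed
  then have "rearrangement M w (t - a) \<le> ennreal l"
    using real by (subst rearrangement_le_iff) auto
  then show ?thesis using real by simp
qed simp

text \<open>
  The plateau function divided by \<open>K\<close> is the competitor in the supremum: it lies in the unit ball, and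
  its rearrangement beyond \<open>a\<close> dominates \<open>w\<^sup>*\<close> shifted by \<open>a\<close>.
\<close>

lemma norm_le_tail_sup:
  assumes Xb: "ri_function_norm half_line Xb" and Yb: "ri_function_norm half_line Yb"
    and w [measurable]: "w \<in> borel_measurable M" and bound: "AE x in M. w x \<le> ennreal b"
    and a: "a > 0" and K: "K > 0"
    and le: "ennreal b * Xb (indicator {0<..a}) + Xb (rearrangement M w) \<le> ennreal K"
    and b: "b \<ge> 0"
  shows "Yb (rearrangement M w) \<le> ennreal K * tail_sup Xb Yb a"
proof -
  interpret X: ri_function_norm half_line Xb by fact
  interpret Y: ri_function_norm half_line Yb by fact
  note [measurable] = rearrangement_measurable
  define s where "s t = rearrangement M w (t - a) * indicator {a<..} t" for t
  define h where "h t = ennreal b * indicator {0<..a} t + s t" for t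
  define f where "f t = ennreal (1 / K) * h t" for t
  have s_borel [measurable]: "s \<in> borel_measurable borel" unfolding s_def by measurable
  have h_borel [measurable]: "h \<in> borel_measurable borel" unfolding h_def by measurable
  have f_borel [measurable]: "f \<in> borel_measurable borel" unfolding f_def by measurable
  note half = borel_measurable_half_line
  have equi: "equimeasurable half_line s (rearrangement M w)"
    unfolding equimeasurable_def s_def
    using emeasure_rearrangement_shift[OF w _ less_imp_le[OF a]] emeasure_rearrangement[OF w] by simp
  have ind: "indicator {0<..a} \<in> borel_measurable half_line" by (rule half) measurable
  have "Xb h \<le> Xb (\<lambda>t. ennreal b * indicator {0<..a} t) + Xb s"
    unfolding h_def by (intro X.triangle half) measurable
  also have "Xb (\<lambda>t. ennreal b * indicator {0<..a} t) = ennreal b * Xb (indicator {0<..a})"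
    by (rule X.scale[OF ind b])
  also have "Xb s = Xb (rearrangement M w)"
    by (intro X.rearrangement_invariant half equi) measurable
  also note le
  finally have Xh: "Xb h \<le> ennreal K" .
  have "Xb f = ennreal (1 / K) * Xb h"
    unfolding f_def using K by (intro X.scale half) auto
  also have "\<dots> \<le> ennreal (1 / K) * ennreal K" using Xh by (intro mult_left_mono) auto
  also have "\<dots> = 1" using K by (simp add: ennreal_mult[symmetric])
  finally have Xf: "Xb f \<le> 1" .
  have h_eq: "h = (\<lambda>t. ennreal K * f t)"
    using K by (intro ext) (simp add: f_def mult.assoc[symmetric] ennreal_mult[symmetric])
  let ?F = "\<lambda>t. rearrangement half_line f t * indicator {a<..} t"
  have s_le: "s t \<le> ennreal K * ?F t" for t
  proof (cases "t > a")
    case True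
    have "s t \<le> rearrangement half_line h t"
      using rearrangement_shift_le_plateau[OF w bound a True] True
      by (simp add: s_def[abs_def] h_def[abs_def])
    also have "\<dots> \<le> ennreal K * rearrangement half_line f t"
      unfolding h_eq by (rule rearrangement_scale_le[OF half[OF f_borel] K])
    finally show ?thesis using True by simp
  qed (simp add: s_def)
  have "Yb (rearrangement M w) = Yb s"
    by (intro Y.rearrangement_invariant[symmetric] half equi) measurable
  also have "\<dots> \<le> Yb (\<lambda>t. ennreal K * ?F t)"
    by (intro Y.mono half AE_I2 s_le) measurable
  also have "\<dots> = ennreal K * Yb ?F"
    using K by (intro Y.scale half) auto
  also have "\<dots> \<le> ennreal K * tail_sup Xb Yb a"
    unfolding tail_sup_def using Xf half[OF f_borel]
    by (intro mult_left_mono SUP_upper) auto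
  finally show ?thesis .
qed

text \<open>The first summand comes from the plateau, whose height is controlled by the decay estimate; the
  second one from \<open>u\<close> itself.\<close>

definition decay_const :: "'n::finite itself \<Rightarrow> real" where
  "decay_const _ = cutoff_bound * max 1 (sphere_area TYPE(real^'n)) / sphere_area TYPE(real^'n) + 1"

lemma decay_const_pos: "decay_const TYPE('n::finite) > 0"
proof -
  have "cutoff_bound > 0" by (simp add: cutoff_bound_def)
  then show ?thesis
    using sphere_area_pos[where 'a="real^'n"] unfolding decay_const_def
    by (intro add_nonneg_pos divide_nonneg_pos mult_nonneg_nonneg) auto
qed

text \<open>
  The case of a vanishing Sobolev norm is separated because the competitor is obtained by
  dividing by that norm.
\<close>

lemma exterior_norm_le:
  fixes X Y :: "(real^'n::finite \<Rightarrow> ennreal) \<Rightarrow> ennreal"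
  assumes X: "ri_function_norm lebesgue X" and Y: "ri_function_norm lebesgue Y"
    and repX: "represents Xb X" and repY: "represents Yb Y"
    and u: "u \<in> W1_rad X" and R: "R > 0"
  shows "exterior_norm Y R u
    \<le> ennreal (decay_const TYPE('n)) * tail_sup Xb Yb (R ^ (CARD('n) - 1)) * W1_norm X u"
proof -
  interpret X: ri_function_norm lebesgue X by fact
  interpret Y: ri_function_norm lebesgue Y by fact
  have Xb: "ri_function_norm half_line Xb" and Yb: "ri_function_norm half_line Yb"
    and X_eq: "\<And>f. f \<in> borel_measurable lebesgue \<Longrightarrow> X f = Xb (rearrangement lebesgue f)"
    and Y_eq: "\<And>f. f \<in> borel_measurable lebesgue \<Longrightarrow> Y f = Yb (rearrangement lebesgue f)"
    using repX repY by (auto simp: represents_def)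
  interpret Xb: ri_function_norm half_line Xb by fact
  define a where "a = R ^ (CARD('n) - 1)"
  define c where "c = sphere_area TYPE(real^'n)"
  define m where "m = max 1 c"
  have a: "a > 0" using R by (simp add: a_def)
  have c: "c > 0" using sphere_area_pos by (simp add: c_def)
  have m: "m \<ge> 1" "m \<ge> c" by (simp_all add: m_def)
  have cb: "cutoff_bound > 0" by (simp add: cutoff_bound_def)
  define v where "v = weak_gradient u"
  have uW: "u \<in> W1 X" and rad: "radially_symmetric u" using u by (auto simp: W1_rad_def)
  have weak: "has_weak_gradient u v"
    using uW someI_ex[of "has_weak_gradient u"]
    by (simp add: W1_def weakly_differentiable_def v_def weak_gradient_def)
  obtain g where g: "AE x in lebesgue. u x = g (norm x)"
    using rad by (auto simp: radially_symmetric_def)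
  have [measurable]: "u \<in> borel_measurable lebesgue" "v \<in> borel_measurable lebesgue"
    using weak by (auto simp: has_weak_gradient_def locally_integrable_def)
  define W where "W = W1_norm X u"
  have W_eq: "W = X (\<lambda>x. ennreal \<bar>u x\<bar>) + X (\<lambda>x. ennreal (norm (v x)))"
    by (simp add: W_def W1_norm_def fnorm_def v_def)
  have W_fin: "W < \<infinity>"
    using uW unfolding W_eq by (simp add: W1_def ri_space_def fnorm_def v_def)
  define w where "w x = ennreal \<bar>u x * indicator (UNIV - ball 0 R) x\<bar>" for x
  have [measurable]: "ball (0::real^'n) R \<in> sets lebesgue" by simp
  have w_meas [measurable]: "w \<in> borel_measurable lebesgue" unfolding w_def by measurable
  have ext_eq: "exterior_norm Y R u = Y w"
    by (simp add: exterior_norm_def fnorm_def w_def[abs_def])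
  have Xw: "X w \<le> X (\<lambda>x. ennreal \<bar>u x\<bar>)"
    by (intro X.mono AE_I2) (auto simp: w_def indicator_def)
  show ?thesis
  proof (cases "W = 0")
    case True
    then have "X w = 0" using Xw unfolding W_eq by (simp add: add_eq_0_iff_both_eq_0)
    then have "Y w = 0" using X.zero_iff[OF w_meas] Y.zero_iff[OF w_meas] by simp
    then show ?thesis by (simp add: ext_eq)
  next
    case False
    define F where "F x = ennreal (\<bar>u x\<bar> + norm (v x))" for x
    have F_meas [measurable]: "F \<in> borel_measurable lebesgue" unfolding F_def by measurable
    have XF: "X F \<le> W"
    proof -
      have "F = (\<lambda>x. ennreal \<bar>u x\<bar> + ennreal (norm (v x)))"
        by (intro ext) (simp add: F_def)
      then show ?thesis unfolding W_eq by (simp only:) (intro X.triangle, measurable)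
    qed
    define G where "G = rearrangement lebesgue F"
    (* The bathtub principle yields the interval (0, m a) with m the sphere area. Enlarging m to be at
       least 1 makes this interval contain (0, a), so that the fundamental function at m a dominates
       the one at a. *)
    define I where "I = (\<integral>\<^sup>+t. G t * indicator {0<..m * a} t \<partial>lborel)"
    let ?ind = "\<lambda>t. indicator {0<..t} :: real \<Rightarrow> ennreal"
    have ind_meas: "?ind t \<in> borel_measurable half_line" for t
      by (rule borel_measurable_half_line) measurable
    have ind_pos: "Xb (?ind t) \<noteq> 0" if "t > 0" for t
    proof
      assume "Xb (?ind t) = 0"
      then have "AE s in half_line. ?ind t s = 0" using Xb.zero_iff[OF ind_meas] by simp
      moreover have eq: "{s \<in> space half_line. \<not> ?ind t s = 0} = {0<..t}"
        by (auto simp: space_half_line indicator_def)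
      moreover have "{0<..t} \<in> sets half_line" by (auto simp: sets_restrict_space_iff)
      ultimately have "emeasure half_line {0<..t} = 0" using AE_iff_measurable[OF _ eq] by simp
      moreover have "emeasure half_line {0<..t} = ennreal t"
        using that by (subst emeasure_half_line) auto
      ultimately show False using that by simp
    qed
    have average: "Xb (?ind (m * a)) * I \<le> ennreal (m * a) * W"
    proof -
      have "Xb (?ind (m * a)) * I \<le> ennreal (m * a) * Xb G"
        unfolding I_def G_def using a m
        by (intro norm_indicator_times_integral_le Xb rearrangement_antimono) simp
      also have "Xb G = X F" by (simp add: G_def X_eq)
      finally show ?thesis using XF by (meson mult_left_mono order_trans zero_le)
    qed
    have I_fin: "I < \<infinity>"
    proof (rule ccontr)
      assume "\<not> I < \<infinity>"
      then have "I = top" by (simp add: top.not_eq_extremum[symmetric])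
      then have "Xb (?ind (m * a)) * I = \<infinity>"
        using ind_pos[of "m * a"] a m by (simp add: ennreal_mult_top)
      moreover have "ennreal (m * a) * W < \<infinity>" using W_fin by (simp add: ennreal_mult_less_top)
      ultimately show False using average by simp
    qed
    define B where "B = enn2real (ennreal (1 / a) * I)"
    have B: "B \<ge> 0" by (simp add: B_def)
    have B_eq: "ennreal B = ennreal (1 / a) * I"
      using I_fin by (simp add: B_def ennreal_mult_less_top)
    have shell: "(\<integral>\<^sup>+x. ennreal (\<bar>u x\<bar> + norm (v x)) * ennreal (shell_weight p x) \<partial>lebesgue) \<le> ennreal B"
      if "p \<ge> R" for p
    proof -
      have "(\<integral>\<^sup>+x. F x * ennreal (shell_weight p x) \<partial>lebesgue)
          \<le> ennreal (1 / a) * (\<integral>\<^sup>+t. rearrangement lebesgue F t * indicator {0<..m * a} t \<partial>lborel)"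
      proof (rule weighted_integral_le_rearrangement[OF sigma_finite_lebesgue F_meas _ a])
        show "(\<lambda>x::real^'n. ennreal (shell_weight p x)) \<in> borel_measurable lebesgue"
          using shell_weight_measurable by measurable
        show "ennreal (shell_weight p x) \<le> ennreal (1 / a)" for x :: "real^'n"
          unfolding a_def by (intro ennreal_leI shell_weight_le R that)
        show "(\<integral>\<^sup>+x. ennreal (shell_weight p (x::real^'n)) \<partial>lebesgue) \<le> ennreal m"
          using R that m by (subst nn_integral_shell_weight) (auto simp: c_def intro: ennreal_leI)
      qed (use m in simp)
      then show ?thesis unfolding B_eq I_def G_def F_def .
    qed
    define b where "b = cutoff_bound / c * B"
    have b: "b \<ge> 0" using cb c B by (simp add: b_def)
    have "AE x in lebesgue. norm x > R \<longrightarrow> \<bar>u x\<bar> \<le> b"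
      unfolding b_def c_def by (rule radial_sup_bound[OF weak g R shell B])
    moreover have "AE x in lebesgue. norm (x::real^'n) \<noteq> R"
      unfolding AE_completion_iff by (intro AE_norm AE_lborel_singleton) measurable
    ultimately have w_bound: "AE x in lebesgue. w x \<le> ennreal b"
    proof eventually_elim
      case (elim x)
      then show ?case using b by (cases "norm x < R") (auto simp: w_def intro: ennreal_leI)
    qed
    define K where "K = decay_const TYPE('n) * enn2real W"
    have K_eq: "ennreal K = ennreal (decay_const TYPE('n)) * W"
      using W_fin decay_const_pos[where 'n='n] by (simp add: K_def ennreal_mult)
    have K: "K > 0"
      using W_fin False decay_const_pos[where 'n='n] by (simp add: K_def enn2real_positive_iff zero_less_iff_neq_zero)
    have "ennreal b * Xb (?ind a) \<le> ennreal (cutoff_bound * m / c) * W"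
    proof -
      have "ennreal b * Xb (?ind a) \<le> ennreal b * Xb (?ind (m * a))"
      proof (intro mult_left_mono Xb.mono ind_meas AE_I2)
        have "a \<le> m * a" using a m by simp
        then show "?ind a s \<le> ?ind (m * a) s" for s by (auto simp: indicator_def)
      qed simp
      also have "\<dots> = ennreal (cutoff_bound / c) * ennreal (1 / a) * (Xb (?ind (m * a)) * I)"
      proof -
        have "ennreal b = ennreal (cutoff_bound / c) * (ennreal (1 / a) * I)"
          unfolding b_def B_eq[symmetric] using cb c B by (intro ennreal_mult) auto
        then show ?thesis by (simp only: mult_ac)
      qed
      also have "\<dots> \<le> ennreal (cutoff_bound / c) * ennreal (1 / a) * (ennreal (m * a) * W)"
        by (intro mult_left_mono average) simp
      also have "\<dots> = ennreal (cutoff_bound / c * (1 / a) * (m * a)) * W"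
      proof -
        have "ennreal (cutoff_bound / c) * ennreal (1 / a) * ennreal (m * a)
            = ennreal (cutoff_bound / c * (1 / a) * (m * a))"
          using cb c a m by (simp flip: ennreal_mult)
        then show ?thesis by (simp only: mult.assoc[symmetric])
      qed
      also have "cutoff_bound / c * (1 / a) * (m * a) = cutoff_bound * m / c" using a by simp
      finally show ?thesis .
    qed
    moreover have "Xb (rearrangement lebesgue w) \<le> W"
    proof -
      have "X w \<le> W" using Xw unfolding W_eq by (rule order_trans) simp
      then show ?thesis by (simp add: X_eq)
    qed
    ultimately have "ennreal b * Xb (?ind a) + Xb (rearrangement lebesgue w)
        \<le> ennreal (cutoff_bound * m / c) * W + W"
      by (rule add_mono)
    also have "\<dots> = ennreal K"
    proof -
      have "ennreal (decay_const TYPE('n)) = ennreal (cutoff_bound * m / c) + 1"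
        unfolding decay_const_def c_def[symmetric] m_def[symmetric]
        using cb c m by (subst ennreal_plus) auto
      then show ?thesis unfolding K_eq by (simp add: distrib_right)
    qed
    finally have "Yb (rearrangement lebesgue w) \<le> ennreal K * tail_sup Xb Yb a"
      by (rule norm_le_tail_sup[OF Xb Yb w_meas w_bound a K _ b])
    then show ?thesis
      unfolding ext_eq Y_eq[OF w_meas] K_eq a_def W_def by (simp add: mult_ac)
  qed
qed

theorem proposition1p2:
  assumes "CARD('n::finite) \<ge> 2"
  shows
    "(\<exists>C::real. C > 0 \<and>
       (\<forall>(X :: (real^'n \<Rightarrow> ennreal) \<Rightarrow> ennreal) (Y :: (real^'n \<Rightarrow> ennreal) \<Rightarrow> ennreal) Xb Yb.
          ri_function_norm lebesgue X \<and> ri_function_norm lebesgue Y \<and>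
          represents Xb X \<and> represents Yb Y \<longrightarrow>
          (\<forall>u \<in> W1_rad X. \<forall>R>0.
             exterior_norm Y R u
               \<le> ennreal C * tail_sup Xb Yb (R ^ (CARD('n) - 1)) * W1_norm X u)))
     \<and>
     (\<forall>(X :: (real^'n \<Rightarrow> ennreal) \<Rightarrow> ennreal) (Y :: (real^'n \<Rightarrow> ennreal) \<Rightarrow> ennreal) Xb Yb.
        ri_function_norm lebesgue X \<and> ri_function_norm lebesgue Y \<and>
        represents Xb X \<and> represents Yb Y \<and>
        (tail_sup Xb Yb \<longlongrightarrow> 0) at_top \<longrightarrow>
        (\<forall>A \<subseteq> W1_rad X. W1_bounded X A \<longrightarrow>
           ((\<lambda>R. SUP u\<in>A. exterior_norm Y R u) \<longlongrightarrow> 0) at_top))"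
proof (intro conjI allI impI)
  let ?C = "decay_const TYPE('n)"
  show "\<exists>C::real. C > 0 \<and>
       (\<forall>(X :: (real^'n \<Rightarrow> ennreal) \<Rightarrow> ennreal) (Y :: (real^'n \<Rightarrow> ennreal) \<Rightarrow> ennreal) Xb Yb.
          ri_function_norm lebesgue X \<and> ri_function_norm lebesgue Y \<and>
          represents Xb X \<and> represents Yb Y \<longrightarrow>
          (\<forall>u \<in> W1_rad X. \<forall>R>0.
             exterior_norm Y R u
               \<le> ennreal C * tail_sup Xb Yb (R ^ (CARD('n) - 1)) * W1_norm X u))"
  proof (intro exI[of _ ?C] conjI allI impI ballI)
    show "?C > 0" by (rule decay_const_pos)
    fix X Y :: "(real^'n \<Rightarrow> ennreal) \<Rightarrow> ennreal" and Xb Yb u and R :: real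
    assume "ri_function_norm lebesgue X \<and> ri_function_norm lebesgue Y \<and>
        represents Xb X \<and> represents Yb Y" "u \<in> W1_rad X" "R > 0"
    then show "exterior_norm Y R u
        \<le> ennreal ?C * tail_sup Xb Yb (R ^ (CARD('n) - 1)) * W1_norm X u"
      by (elim conjE) (rule exterior_norm_le)
  qed
  fix X Y :: "(real^'n \<Rightarrow> ennreal) \<Rightarrow> ennreal" and Xb Yb A
  assume H: "ri_function_norm lebesgue X \<and> ri_function_norm lebesgue Y \<and>
        represents Xb X \<and> represents Yb Y \<and> (tail_sup Xb Yb \<longlongrightarrow> 0) at_top"
    and A: "A \<subseteq> W1_rad X" "W1_bounded X A"
  obtain K :: real where K: "\<And>u. u \<in> A \<Longrightarrow> W1_norm X u \<le> ennreal K"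
    using A(2) by (auto simp: W1_bounded_def)
  (* In dimension 1 the exponent would vanish; two dimensions make the truncation point grow with R. *)
  have pow: "filterlim (\<lambda>R::real. R ^ (CARD('n) - 1)) at_top at_top"
    using assms by (intro filterlim_pow_at_top filterlim_ident) simp
  have "(tail_sup Xb Yb \<longlongrightarrow> 0) at_top" using H by blast
  then have limR: "((\<lambda>R. tail_sup Xb Yb (R ^ (CARD('n) - 1))) \<longlongrightarrow> 0) at_top"
    using pow by (rule filterlim_compose)
  have lim: "((\<lambda>R. (ennreal ?C * ennreal K) * tail_sup Xb Yb (R ^ (CARD('n) - 1))) \<longlongrightarrow> 0) at_top"
  proof -
    have "ennreal ?C * ennreal K < top" by (simp add: ennreal_mult_less_top)
    from ennreal_tendsto_cmult[OF this limR] show ?thesis by simp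
  qed
  have "\<forall>\<^sub>F R in at_top. (SUP u\<in>A. exterior_norm Y R u)
      \<le> (ennreal ?C * ennreal K) * tail_sup Xb Yb (R ^ (CARD('n) - 1))"
    using eventually_gt_at_top[of 0]
  proof eventually_elim
    case (elim R)
    show ?case
    proof (rule SUP_least)
      fix u assume u: "u \<in> A"
      have "exterior_norm Y R u \<le> ennreal ?C * tail_sup Xb Yb (R ^ (CARD('n) - 1)) * W1_norm X u"
        using H A(1) u elim by (intro exterior_norm_le) auto
      also have "\<dots> \<le> ennreal ?C * tail_sup Xb Yb (R ^ (CARD('n) - 1)) * ennreal K"
        by (intro mult_left_mono K u) simp
      finally show "exterior_norm Y R u
          \<le> (ennreal ?C * ennreal K) * tail_sup Xb Yb (R ^ (CARD('n) - 1))"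
        by (simp add: mult_ac)
    qed
  qed
  then show "((\<lambda>R. SUP u\<in>A. exterior_norm Y R u) \<longlongrightarrow> 0) at_top"
    by (intro tendsto_sandwich[OF _ _ tendsto_const lim]) auto
qed

end
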